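(* Consider the game $\mathbf{0.33}$ and the set $\mathcal{R}$ consisting of the empty graph and all subdivided stars whose paths all have $1$ or $2$ vertices. Define the following subsets of $\mathcal{R}$: $\mathcal C_1^*=\{P_1, S_{2,1}, S_{2,2,2}\}$; $\mathcal C_2^*=\{S_1, S_{2,2}\}$; $\mathcal C_2^{\Box}$ = stars $S\in\mathcal R$ with $\mathcal{G}(S)=2$ having exactly one or exactly three paths with $2$ vertices; $\mathcal C_3^{\Box}$ = stars $S\in\mathcal R$ with $\mathcal{G}(S)=3$ having exactly one or exactly three paths with $2$ vertices; and for $i\in\{0,1,2,3\}$, $\mathcal C_i$ = elements $S\in\mathcal R$ with $\mathcal{G}(S)=i$ not in any of $\mathcal C_1^*,\mathcal C_2^*,\mathcal C_2^{\Box},\mathcal C_3^{\Box}$. Then the equivalence classes of $\mathcal R$ under $\sim_1$ are exactly $\mathcal C_0,\mathcal C_1,\mathcal C_1^*,\mathcal C_2,\mathcal C_2^*,\mathcal C_2^{\Box},\mathcal C_3,\mathcal C_3^{\Box}$. Moreover, for $S,S'\in\mathcal R$, $\mathcal{G}(S\overset{1}{-}S')=\mathcal{G}(S)\oplus\mathcal{G}(S')$ except in the following cases (and their symmetric ones, swapping $S$ and $S'$): if $S,S'\in\mathcal C_1^*$ then the value is $2$; if $S\in\mathcal C_1^*$, $S'\in\mathcal C_2^*$ then it is $0$; if $S,S'\in\mathcal C_2^*$ then it is $1$; if $S\in\mathcal C_2^*$, $S'\in\mathcal C_2^{\Box}$ then it is $1$; if $S\in\mathcal C_2^*$, $S'\in\mathcal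 C_3^{\Box}$ then it is $0$.
   Context: The game $\mathbf{0.33}$ on a finite graph $G$: players alternate; a move chooses a set $X$ of one vertex or of two adjacent vertices of $G$, lying in a connected component $H$ of $G$, such that $H-X$ is empty or connected, and deletes $X$. A player unable to move loses (normal play). Grundy value: $\mathcal{G}(G)=\mathrm{mex}\{\mathcal{G}(G'): G' \text{ reachable in one move}\}$; $\oplus$ is bitwise XOR (nim-sum). Subdivided star $S_{\ell_1,\ldots,\ell_k}$ ($k\ge0$, $\ell_i\ge1$): a central vertex $c$ with $k$ vertex-disjoint paths of $\ell_1,\ldots,\ell_k$ vertices each having one endpoint adjacent to $c$ ($P_1$ if $k=0$; $S_1=P_2$). Bistar: for subdivided stars $S,S'$ with centers $c,c'$, $S\overset{1}{-}S'$ is the disjoint union of $S$ and $S'$ plus the edge $cc'$; if one of them is the empty graph, $S\overset{1}{-}\emptyset=\emptyset\overset{1}{-}S=S$. Two graphs are equivalent, $G_1\equiv G_2$, iff $\mathcal{G}(G_1)=\mathcal{G}(G_2)$. For $S,S'$ (subdivided stars or empty), $S\sim_1 S'$ iff $S\overset{1}{-}\hat S\equiv S'\overset{1}{-}\hat S$ for every subdivided star $\hat S$ (or empty graph $\hat S$). *)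

theory Defs
  imports "Graph_Theory.Digraph_Component" "HOL-Library.Multiset"
begin

text \<open>
  Undirected graphs are symmetric, loop-free digraphs without parallel arcs (locale \<^locale>\<open>graph\<close>).
  A connected component is a maximal connected subgraph; \<^const>\<open>connected\<close> excludes the empty graph,
  so the case that the move removes a whole component is listed separately.
\<close>

definition move033 :: "('a, 'b) pre_digraph \<Rightarrow> ('a, 'b) pre_digraph \<Rightarrow> bool" where
  "move033 G G' \<longleftrightarrow> (\<exists>H X. pre_digraph.max_subgraph G connected H \<and> X \<subseteq> verts H \<and>
     ((\<exists>u. X = {u}) \<or> (\<exists>u v. u \<rightarrow>\<^bsub>G\<^esub> v \<and> X = {u, v})) \<and>
     (verts H - X = {} \<or> connected (H \<restriction> (verts H - X))) \<and>
     G' = G \<restriction> (verts G - X))"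

lemma move033_card_less:
  assumes "finite (verts G)" "move033 G G'"
  shows "card (verts G') < card (verts G)"
proof -
  obtain H X where H: "pre_digraph.max_subgraph G connected H" "X \<subseteq> verts H" "X \<noteq> {}"
      and G': "G' = G \<restriction> (verts G - X)"
    using assms(2) unfolding move033_def by blast
  have "X \<subseteq> verts G"
    using H(1,2) by (auto simp: pre_digraph.max_subgraph_def subgraph_def)
  then have "verts G - X \<subset> verts G" using H(3) by blast
  then show ?thesis
    using assms(1) by (simp add: G' psubset_card_mono)
qed

definition mex :: "nat set \<Rightarrow> nat" where
  "mex A = (LEAST n. n \<notin> A)"

text \<open>The value 0 on infinite graphs is a dummy; the game is only played on finite graphs.\<close>

function grundy :: "('a, 'b) pre_digraph \<Rightarrow> nat" where
  "grundy G = (if finite (verts G) then mex (grundy ` {G'. move033 G G'}) else 0)"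
  by auto
termination
  by (relation "measure (\<lambda>G. card (verts G))") (auto simp: move033_card_less)

declare grundy.simps [simp del]

text \<open>
  The subdivided star with path lengths \<open>l\<^sub>1, \<dots>, l\<^sub>k\<close> is encoded as \<open>Some {#l\<^sub>1, \<dots>, l\<^sub>k#}\<close>, which
  determines it up to isomorphisms preserving the centre, and the empty graph as \<open>None\<close>.
  Thus \<open>P\<^sub>1\<close> is \<open>Some {#}\<close>. The centre is part of the data: \<open>S\<^sub>2\<close> and \<open>S\<^sub>1\<^sub>,\<^sub>1\<close> are isomorphic as
  graphs, but have different centres and give different bistars.
\<close>

type_synonym star = "nat multiset option"

definition is_star :: "star \<Rightarrow> bool" where
  "is_star S \<longleftrightarrow> (\<forall>L. S = Some L \<longrightarrow> 0 \<notin># L)"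

text \<open>
  \<open>Arm l j i\<close> is the vertex at distance \<open>i\<close> from the centre on the \<open>j\<close>-th of the paths of length \<open>l\<close>.
\<close>

datatype star_vertex = Center | Arm nat nat nat

fun star_graph :: "star \<Rightarrow> (star_vertex, star_vertex \<times> star_vertex) pre_digraph" where
  "star_graph None = \<lparr> verts = {}, arcs = {}, tail = fst, head = snd \<rparr>"
| "star_graph (Some L) =
     (let E = {(Center, Arm l j 1) | l j. j < count L l} \<union>
              {(Arm l j i, Arm l j (Suc i)) | l j i. j < count L l \<and> 1 \<le> i \<and> i < l}
      in \<lparr> verts = insert Center {Arm l j i | l j i. j < count L l \<and> 1 \<le> i \<and> i \<le> l},
           arcs = E \<union> E\<inverse>, tail = fst, head = snd \<rparr>)"

definition bistar ::
  "star \<Rightarrow> star \<Rightarrow> (star_vertex + star_vertex, (star_vertex + star_vertex) \<times> (star_vertex + star_vertex)) pre_digraph"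
where
  "bistar S T = \<lparr>
     verts = Inl ` verts (star_graph S) \<union> Inr ` verts (star_graph T),
     arcs = map_prod Inl Inl ` arcs (star_graph S) \<union> map_prod Inr Inr ` arcs (star_graph T) \<union>
       (if S = None \<or> T = None then {} else {(Inl Center, Inr Center), (Inr Center, Inl Center)}),
     tail = fst, head = snd \<rparr>"

definition star_grundy :: "star \<Rightarrow> nat" where
  "star_grundy S = grundy (star_graph S)"

definition sim1 :: "star \<Rightarrow> star \<Rightarrow> bool"  (infix \<open>\<sim>\<^sub>1\<close> 50) where
  "S \<sim>\<^sub>1 S' \<longleftrightarrow> (\<forall>T. is_star T \<longrightarrow> grundy (bistar S T) = grundy (bistar S' T))"

definition stars12 :: "star set" where
  "stars12 = {None} \<union> {Some L | L. set_mset L \<subseteq> {1, 2}}"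

definition C1_star :: "star set" where
  "C1_star = {Some {#}, Some {#2, 1#}, Some {#2, 2, 2#}}"

definition C2_star :: "star set" where
  "C2_star = {Some {#1#}, Some {#2, 2#}}"

definition C_box :: "nat \<Rightarrow> star set" where
  "C_box i = {S \<in> stars12. star_grundy S = i \<and> (\<exists>L. S = Some L \<and> (count L 2 = 1 \<or> count L 2 = 3))}"

definition C :: "nat \<Rightarrow> star set" where
  "C i = {S \<in> stars12. star_grundy S = i \<and> S \<notin> C1_star \<union> C2_star \<union> C_box 2 \<union> C_box 3}"

lemma graph_star_graph:
  assumes "is_star S"
  shows "graph (star_graph S)"
proof (cases S)
  case None
  then show ?thesis
    by unfold_locales (auto simp: symmetric_def arcs_ends_def arc_to_ends_def sym_def)
next
  case (Some L)
  have pos: "l > 0" if "j < count L l" for l j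
    using that assms Some by (cases l) (auto simp: is_star_def not_in_iff)
  let ?V = "insert Center (\<Union>l\<in>set_mset L. \<Union>j\<in>{..<count L l}. \<Union>i\<in>{..l}. {Arm l j i})"
  have V: "verts (star_graph S) \<subseteq> ?V"
    using Some by (auto simp: Let_def Bex_def count_greater_zero_iff[symmetric] simp del: count_greater_zero_iff)
  have fin: "finite (verts (star_graph S))"
    by (rule finite_subset[OF V]) auto
  have A: "arcs (star_graph S) \<subseteq> verts (star_graph S) \<times> verts (star_graph S)"
    using Some by (auto simp: Let_def Suc_le_eq dest: pos)
  have finA: "finite (arcs (star_graph S))"
    by (rule finite_subset[OF A]) (simp add: fin)
  have th: "tail (star_graph S) = fst" "head (star_graph S) = snd"
    using Some by (auto simp: Let_def)
  have sy: "sym (arcs (star_graph S))"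
    using Some by (auto simp: Let_def sym_Un_converse)
  have irr: "fst e \<noteq> snd e" if "e \<in> arcs (star_graph S)" for e
    using Some that by (auto simp: Let_def)
  show ?thesis
    using A fin finA sy irr
    by unfold_locales (auto simp: th symmetric_def arcs_ends_def arc_to_ends_def)
qed

lemma graph_bistar:
  assumes "is_star S" "is_star T"
  shows "graph (bistar S T)"
proof -
  interpret S: graph "star_graph S" using assms(1) by (rule graph_star_graph)
  interpret T: graph "star_graph T" using assms(2) by (rule graph_star_graph)
  have th: "tail (star_graph U) = fst" "head (star_graph U) = snd" for U
    by (cases U; simp add: Let_def)+
  have c: "Center \<in> verts (star_graph U)" if "U \<noteq> None" for U
    using that by (auto simp: Let_def)
  have "sym (arcs (star_graph S))" "sym (arcs (star_graph T))"
    using S.sym_arcs T.sym_arcs by (auto simp: symmetric_def arcs_ends_def arc_to_ends_def th)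
  moreover have "sym (map_prod f f ` A)" if "sym A"
    for A :: "star_vertex rel" and f :: "star_vertex \<Rightarrow> star_vertex + star_vertex"
  proof (rule symI)
    fix x y assume "(x, y) \<in> map_prod f f ` A"
    then obtain a b where "x = f a" "y = f b" "(a, b) \<in> A" by auto
    then show "(y, x) \<in> map_prod f f ` A"
      using symD[OF that] by (metis map_prod_imageI)
  qed
  ultimately have sy: "sym (arcs (bistar S T))"
    unfolding bistar_def pre_digraph.simps by (intro sym_Un) (auto simp: sym_def)
  have w: "a \<in> verts (star_graph U)" "b \<in> verts (star_graph U)" "a \<noteq> b"
    if "(a, b) \<in> arcs (star_graph U)" "is_star U" for a b U
  proof -
    interpret U: graph "star_graph U" using that(2) by (rule graph_star_graph)
    show "a \<in> verts (star_graph U)" "b \<in> verts (star_graph U)" "a \<noteq> b"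
      using U.tail_in_verts[OF that(1)] U.head_in_verts[OF that(1)] U.no_loops[OF that(1)]
      by (auto simp: th)
  qed
  have thb: "tail (bistar S T) = fst" "head (bistar S T) = snd"
    by (auto simp: bistar_def)
  have W: "fst e \<in> verts (bistar S T) \<and> snd e \<in> verts (bistar S T) \<and> fst e \<noteq> snd e"
    if e: "e \<in> arcs (bistar S T)" for e
  proof -
    consider (1) a b where "e = (Inl a, Inl b)" "(a, b) \<in> arcs (star_graph S)"
      | (2) a b where "e = (Inr a, Inr b)" "(a, b) \<in> arcs (star_graph T)"
      | (3) "S \<noteq> None" "T \<noteq> None" "e = (Inl Center, Inr Center) \<or> e = (Inr Center, Inl Center)"
      using e by (auto simp: bistar_def simp del: star_graph.simps not_None_eq split: if_splits)
    then show ?thesis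
    proof cases
      case 1
      then show ?thesis using w[OF 1(2) assms(1)] by (simp add: bistar_def)
    next
      case 2
      then show ?thesis using w[OF 2(2) assms(2)] by (simp add: bistar_def)
    next
      case 3
      then show ?thesis using c[OF 3(1)] c[OF 3(2)] by (auto simp: bistar_def simp del: star_graph.simps)
    qed
  qed
  have fin: "finite (verts (bistar S T))" "finite (arcs (bistar S T))"
    by (auto simp: bistar_def)
  show ?thesis
    using W fin sy
    by unfold_locales (auto simp: thb symmetric_def arcs_ends_def arc_to_ends_def)
qed

lemma equiv_sim1: "equiv A {(S, S'). S \<in> A \<and> S' \<in> A \<and> S \<sim>\<^sub>1 S'}"
  by (auto simp: sim1_def equiv_def refl_on_def sym_def trans_def)

end

theory Submission
  imports Defs
begin

text \<open>
  The Grundy value of a bistar depends only on the numbers of paths of length congruent to 1 and to 2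
  modulo 3 on either side, through eight classes. Shortening a path by one or two vertices changes its
  residue to one of the other two residues, and any two classes related by such a change have different
  values in every bistar; conversely, the changes that are always available reach every smaller value.
  The symmetry of this relation makes the additional moves of long paths harmless. The moves that
  delete a centre are legal only if a component collapses to a path or loses a side of one or two
  vertices, and are checked one by one.
\<close>

section \<open>The game on induced subgraphs of a symmetric relation\<close>

text \<open>The relation \<open>sim1\<close> tests against every subdivided star, so bistars with
  paths of arbitrary length have to be evaluated although only stars with paths of 1 or 2 vertices
  are classified; this is why residues modulo 3 enter. Play starting from a bistar also meets stars
  with one side gone and bare paths. An absent side is therefore given the class \<open>K0\<close>:
  joining with \<open>K0\<close> returns the plain value, so a star is a bistar with an empty side,
  and losing a side is merely a change of class to \<open>K0\<close>. One induction then covers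
  stars and bistars, and bare paths are a subtraction game evaluated beforehand. Nim-sum fails
  because a centre with hardly any paths can itself be deleted: two bare centres joined by an edge
  form a path on 2 vertices, of value 2, whereas the nim-sum of 1 and 1 is 0. All positions are
  vertex sets of one infinite symmetric graph, so a move is a set difference and no isomorphism has
  to be carried through the induction.\<close>

definition relgraph :: "'a rel \<Rightarrow> 'a set \<Rightarrow> ('a, 'a \<times> 'a) pre_digraph" where
  "relgraph E W = \<lparr>verts = W, arcs = E \<inter> W \<times> W, tail = fst, head = snd\<rparr>"

definition conn :: "'a rel \<Rightarrow> 'a set \<Rightarrow> bool" where
  "conn E W \<longleftrightarrow> W \<noteq> {} \<and> (\<forall>u\<in>W. \<forall>v\<in>W. (u, v) \<in> (E \<inter> W \<times> W)\<^sup>*)"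

abbreviation gr :: "'a rel \<Rightarrow> 'a set \<Rightarrow> nat" where
  "gr E W \<equiv> grundy (relgraph E W)"

lemma relgraph_simps [simp]:
  "verts (relgraph E W) = W" "arcs (relgraph E W) = E \<inter> W \<times> W"
  "tail (relgraph E W) = fst" "head (relgraph E W) = snd"
  by (auto simp: relgraph_def)

lemma wf_digraph_relgraph: "wf_digraph (relgraph E W)"
  by unfold_locales auto

lemma arcs_ends_relgraph: "arcs_ends (relgraph E W) = E \<inter> W \<times> W"
  by (auto simp: arcs_ends_def arc_to_ends_def)

lemma relgraph_restrict: "V \<subseteq> W \<Longrightarrow> relgraph E W \<restriction> V = relgraph E V"
  by (auto simp: relgraph_def induce_subgraph_def)

lemma rtrancl_on_iff_rtrancl:
  assumes "u \<in> W"
  shows "(u, v) \<in> rtrancl_on W (E \<inter> W \<times> W) \<longleftrightarrow> (u, v) \<in> (E \<inter> W \<times> W)\<^sup>*"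
proof
  assume "(u, v) \<in> rtrancl_on W (E \<inter> W \<times> W)"
  then show "(u, v) \<in> (E \<inter> W \<times> W)\<^sup>*"
    by (induction rule: rtrancl_on_induct) (auto intro: rtrancl_into_rtrancl)
next
  assume "(u, v) \<in> (E \<inter> W \<times> W)\<^sup>*"
  then show "(u, v) \<in> rtrancl_on W (E \<inter> W \<times> W)"
    by (induction rule: rtrancl_induct) (use assms in \<open>auto intro: rtrancl_on_into_rtrancl_on\<close>)
qed

lemma connected_relgraph:
  assumes "sym E"
  shows "connected (relgraph E W) \<longleftrightarrow> conn E W"
proof -
  have "symcl (arcs_ends (relgraph E W)) = E \<inter> W \<times> W"
    using assms by (auto simp: symcl_def arcs_ends_relgraph sym_def)
  then show ?thesis
    by (simp add: connected_conv conn_def rtrancl_on_iff_rtrancl)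
qed

lemma max_subgraph_connected:
  assumes "wf_digraph G" "connected G"
  shows "pre_digraph.max_subgraph G connected H \<longleftrightarrow> H = G"
proof -
  interpret wf_digraph G by fact
  show ?thesis
  proof
    assume "max_subgraph connected H"
    then show "H = G" using assms(2) subgraph_refl by (auto simp: max_subgraph_def)
  next
    have "H' = G" if "subgraph G H'" "subgraph H' G" for H'
      using that by (auto simp: subgraph_def compatible_def intro!: pre_digraph.equality)
    then show "max_subgraph connected H" if "H = G"
      using that assms(2) subgraph_refl by (auto simp: max_subgraph_def)
  qed
qed

text \<open>Recording what remains, rather than what is deleted, gives positions and options the
  same type. The case \<open>u = v\<close> is the deletion of one vertex.\<close>

definition removals :: "'a rel \<Rightarrow> 'a set \<Rightarrow> 'a set set" where
  "removals E W = {R. \<exists>u v. u \<in> W \<and> v \<in> W \<and> (u = v \<or> (u, v) \<in> E) \<and> R = W - {u, v} \<and> (R = {} \<or> conn E R)}"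

text \<open>A connected graph is its own only component, so the component in \<open>move033\<close>
  disappears. Options are again empty or connected, hence the formula can be iterated along a
  play.\<close>

lemma gr_conn:
  assumes "sym E" "finite W" "conn E W"
  shows "gr E W = mex (gr E ` removals E W)"
proof -
  have "move033 (relgraph E W) G' \<longleftrightarrow> (\<exists>R\<in>removals E W. G' = relgraph E R)" for G'
  proof -
    have "move033 (relgraph E W) G' \<longleftrightarrow> (\<exists>X\<subseteq>W. ((\<exists>u. X = {u}) \<or> (\<exists>u v. (u, v) \<in> E \<inter> W \<times> W \<and> X = {u, v})) \<and>
      (W - X = {} \<or> connected (relgraph E W \<restriction> (W - X))) \<and> G' = relgraph E W \<restriction> (W - X))"
      using assms(1,3)
      by (simp add: move033_def max_subgraph_connected wf_digraph_relgraph connected_relgraph arcs_ends_relgraph)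
    also have "\<dots> \<longleftrightarrow> (\<exists>X\<subseteq>W. ((\<exists>u. X = {u}) \<or> (\<exists>u v. (u, v) \<in> E \<inter> W \<times> W \<and> X = {u, v})) \<and>
      (W - X = {} \<or> conn E (W - X)) \<and> G' = relgraph E (W - X))"
      using assms(1) by (simp add: relgraph_restrict connected_relgraph)
    also have "\<dots> \<longleftrightarrow> (\<exists>R\<in>removals E W. G' = relgraph E R)"
    proof
      assume "\<exists>X\<subseteq>W. ((\<exists>u. X = {u}) \<or> (\<exists>u v. (u, v) \<in> E \<inter> W \<times> W \<and> X = {u, v})) \<and>
      (W - X = {} \<or> conn E (W - X)) \<and> G' = relgraph E (W - X)"
      then obtain X where X: "X \<subseteq> W" "(\<exists>u. X = {u}) \<or> (\<exists>u v. (u, v) \<in> E \<inter> W \<times> W \<and> X = {u, v})"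
          "W - X = {} \<or> conn E (W - X)" "G' = relgraph E (W - X)" by (elim exE conjE)
      from X(2) obtain u v where uv: "X = {u, v}" "u = v \<or> (u, v) \<in> E" by auto
      then have "W - X \<in> removals E W"
        using X(1,3) unfolding removals_def by blast
      then show "\<exists>R\<in>removals E W. G' = relgraph E R" using X(4) by blast
    next
      assume "\<exists>R\<in>removals E W. G' = relgraph E R"
      then obtain u v where "u \<in> W" "v \<in> W" "u = v \<or> (u, v) \<in> E" "W - {u, v} = {} \<or> conn E (W - {u, v})"
        "G' = relgraph E (W - {u, v})" unfolding removals_def by blast
      then show "\<exists>X\<subseteq>W. ((\<exists>u. X = {u}) \<or> (\<exists>u v. (u, v) \<in> E \<inter> W \<times> W \<and> X = {u, v})) \<and>
        (W - X = {} \<or> conn E (W - X)) \<and> G' = relgraph E (W - X)"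
        by (intro exI[of _ "{u, v}"]) auto
    qed
    finally show ?thesis .
  qed
  then have "{G'. move033 (relgraph E W) G'} = relgraph E ` removals E W" by auto
  then show ?thesis
    using assms(2) by (subst grundy.simps) (simp add: image_image)
qed

lemma mex_eqI: "n \<notin> A \<Longrightarrow> (\<And>m. m < n \<Longrightarrow> m \<in> A) \<Longrightarrow> mex A = n"
  unfolding mex_def by (rule Least_equality) (auto simp: not_less[symmetric])

lemma gr_empty [simp]: "gr E {} = 0"
proof -
  have "{G'. move033 (relgraph E {}) G'} = {}"
    by (auto simp: move033_def pre_digraph.max_subgraph_def subgraph_def)
  moreover have "mex {} = 0" by (rule mex_eqI) auto
  ultimately show ?thesis by (subst grundy.simps) (simp only: relgraph_simps finite.emptyI if_True image_empty)
qed

section \<open>Connected vertex sets and transport along injections\<close>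

lemma connI:
  assumes "sym E" "r \<in> W" "\<And>x. x \<in> W \<Longrightarrow> (x, r) \<in> (E \<inter> W \<times> W)\<^sup>*"
  shows "conn E W"
proof -
  have "sym ((E \<inter> W \<times> W)\<^sup>*)"
    using assms(1) by (intro sym_rtrancl) (auto simp: sym_def)
  then show ?thesis
    using assms(2,3) unfolding conn_def by (meson empty_iff rtrancl_trans symD)
qed

text \<open>Legality of a move is exploited through this fact: a piece of the remainder that no edge
  leaves must be the entire remainder.\<close>

lemma conn_closed_subset:
  assumes "conn E R" "Z \<subseteq> R" "Z \<noteq> {}" "\<And>x y. x \<in> Z \<Longrightarrow> y \<in> R \<Longrightarrow> (x, y) \<in> E \<Longrightarrow> y \<in> Z"
  shows "R = Z"
proof -
  obtain z where z: "z \<in> Z" using assms(3) by blast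
  have "y \<in> Z" if "y \<in> R" for y
  proof -
    have "(z, y) \<in> (E \<inter> R \<times> R)\<^sup>*" using assms(1,2) z that by (auto simp: conn_def)
    then show ?thesis by (induction rule: rtrancl_induct) (use z assms(4) in auto)
  qed
  then show ?thesis using assms(2) by blast
qed

lemma conn_image:
  assumes "inj h" "\<And>x y. (h x, h y) \<in> F \<longleftrightarrow> (x, y) \<in> E"
  shows "conn F (h ` W) \<longleftrightarrow> conn E W"
proof -
  have 1: "F \<inter> h ` W \<times> h ` W = map_prod h h ` (E \<inter> W \<times> W)"
    using assms by auto
  have "(h u, h v) \<in> (map_prod h h ` D)\<^sup>* \<longleftrightarrow> (u, v) \<in> D\<^sup>*" for u v and D :: "'a rel"
  proof
    assume "(u, v) \<in> D\<^sup>*"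
    then show "(h u, h v) \<in> (map_prod h h ` D)\<^sup>*"
      by (induction rule: rtrancl_induct) (auto intro: rtrancl_into_rtrancl)
  next
    assume "(h u, h v) \<in> (map_prod h h ` D)\<^sup>*"
    then have "\<exists>v'. h v = h v' \<and> (u, v') \<in> D\<^sup>*"
    proof (induction rule: rtrancl_induct)
      case (step y z)
      then obtain y' z' where "(y', z') \<in> D" "y = h y'" "z = h z'" by auto
      then show ?case using step.IH assms(1) by (metis injD rtrancl_into_rtrancl)
    qed auto
    then show "(u, v) \<in> D\<^sup>*" using injD[OF assms(1)] by blast
  qed
  then show ?thesis by (auto simp: conn_def 1)
qed

text \<open>Needed once, to compare a star with the bistar it forms with the empty graph, whose
  vertices carry a sum tag. Since \<open>gr_conn\<close> speaks of connected sets only, the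
  induction is restricted to these and the empty set.\<close>

lemma gr_image:
  assumes "sym E" "sym F" "inj h" "\<And>x y. (h x, h y) \<in> F \<longleftrightarrow> (x, y) \<in> E"
    and "finite W" "W = {} \<or> conn E W"
  shows "gr F (h ` W) = gr E W"
  using assms(5,6)
proof (induction W rule: finite_psubset_induct)
  case (psubset W)
  show ?case
  proof (cases "W = {}")
    case False
    then have c: "conn E W" using psubset.prems by blast
    have r: "removals F (h ` W) = image h ` removals E W"
    proof (intro equalityI subsetI)
      fix R assume "R \<in> removals F (h ` W)"
      then obtain u v where uv: "u \<in> W" "v \<in> W" "h u = h v \<or> (h u, h v) \<in> F" "R = h ` W - {h u, h v}"
        "R = {} \<or> conn F R" unfolding removals_def by blast
      have R: "R = h ` (W - {u, v})" using uv(4) assms(3) by (auto simp: inj_eq)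
      have "W - {u, v} \<in> removals E W"
        using uv(1-3,5) conn_image[OF assms(3,4)] assms(3,4) unfolding removals_def R
        by (auto simp: inj_eq)
      then show "R \<in> image h ` removals E W" unfolding R by blast
    next
      fix R assume "R \<in> image h ` removals E W"
      then obtain u v where uv: "u \<in> W" "v \<in> W" "u = v \<or> (u, v) \<in> E" "R = h ` (W - {u, v})"
        "W - {u, v} = {} \<or> conn E (W - {u, v})" unfolding removals_def by blast
      have R: "R = h ` W - {h u, h v}" using uv(4) assms(3) by (auto simp: inj_eq)
      moreover have "R = {} \<or> conn F R"
        using uv(4,5) conn_image[OF assms(3,4)] by auto
      ultimately show "R \<in> removals F (h ` W)"
        using uv(1-3) assms(4) unfolding removals_def by blast
    qed
    have "gr F (h ` W) = mex (gr F ` removals F (h ` W))"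
      using psubset.hyps c by (intro gr_conn) (auto simp: assms conn_image[OF assms(3,4)])
    also have "gr F ` removals F (h ` W) = gr E ` removals E W"
      unfolding r image_image
    proof (rule image_cong[OF refl])
      fix R assume "R \<in> removals E W"
      then have "R \<subset> W" "R = {} \<or> conn E R" unfolding removals_def by blast+
      then show "gr F (h ` R) = gr E R" by (rule psubset.IH)
    qed
    also have "mex \<dots> = gr E W" using psubset.hyps c assms(1) by (simp add: gr_conn)
    finally show ?thesis .
  qed simp
qed


section \<open>The eight classes\<close>

text \<open>The digit is the Grundy value; the suffix \<open>s\<close> stands for the starred
  classes and \<open>b\<close> for the box classes.\<close>

datatype cls = K0 | K1 | K1s | K2 | K2s | K2b | K3 | K3b

fun val :: "cls \<Rightarrow> nat" where
  "val K0 = 0" | "val K1 = 1" | "val K1s = 1" | "val K2 = 2"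
| "val K2s = 2" | "val K2b = 2" | "val K3 = 3" | "val K3b = 3"

definition join :: "cls \<Rightarrow> cls \<Rightarrow> nat" where
  "join c d =
    (if c = K1s \<and> d = K1s then 2
     else if c = K1s \<and> d = K2s \<or> c = K2s \<and> d = K1s then 0
     else if c = K2s \<and> d = K2s then 1
     else if c = K2s \<and> d = K2b \<or> c = K2b \<and> d = K2s then 1
     else if c = K2s \<and> d = K3b \<or> c = K3b \<and> d = K2s then 0
     else xor (val c) (val d))"

text \<open>\<open>star_cls a b\<close> is the class of a star with \<open>a\<close> paths of length congruent to 1 and \<open>b\<close> paths of
  length congruent to 2 modulo 3; paths of length divisible by 3 have no influence.\<close>

definition star_cls :: "nat \<Rightarrow> nat \<Rightarrow> cls" where
  "star_cls a b =
    (if (a, b) \<in> {(0, 0), (1, 1), (0, 3)} then K1s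
     else if (a, b) \<in> {(1, 0), (0, 2)} then K2s
     else if (a, b) = (0, 1) then K0
     else if b = 1 then if even a then K2b else K3b
     else if b = 3 then if even a then K3b else K2b
     else if b = 2 then if even a then K1 else K0
     else if even b then if even a then K0 else K1
     else if even a then K2 else K3)"

lemma join_comm: "join c d = join d c"
  by (cases c; cases d) (simp_all add: join_def)

lemma join_K0 [simp]: "join c K0 = val c" "join K0 c = val c"
  by (cases c; simp add: join_def)+

text \<open>Different values alone would not do: a move on one side leaves the other side fixed but
  arbitrary, so the value has to change against every class there.\<close>

definition separated :: "cls \<Rightarrow> cls \<Rightarrow> bool" where
  "separated c d \<longleftrightarrow> (\<forall>e. join c e \<noteq> join d e)"

lemma all_cls: "(\<forall>c. P c) \<longleftrightarrow> P K0 \<and> P K1 \<and> P K1s \<and> P K2 \<and> P K2s \<and> P K2b \<and> P K3 \<and> P K3b"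
  by (metis cls.exhaust)

lemma ex_cls: "(\<exists>c. P c) \<longleftrightarrow> P K0 \<or> P K1 \<or> P K1s \<or> P K2 \<or> P K2s \<or> P K2b \<or> P K3 \<or> P K3b"
  by (metis cls.exhaust)

lemma separated_sym: "separated c d \<Longrightarrow> separated d c"
  by (auto simp: separated_def eq_commute)

text \<open>These are all separated pairs, in both orders. Any other two distinct classes agree
  against some class: for instance \<open>K1\<close> and \<open>K2s\<close> both give 0 against
  \<open>K1s\<close>.\<close>

lemma separated_simps [simp]:
  "separated K0 K1" "separated K1 K0" "separated K0 K1s" "separated K1s K0"
  "separated K0 K2" "separated K2 K0" "separated K0 K2b" "separated K2b K0"
  "separated K0 K2s" "separated K2s K0" "separated K0 K3" "separated K3 K0"
  "separated K0 K3b" "separated K3b K0" "separated K1 K2" "separated K2 K1"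
  "separated K1 K2b" "separated K2b K1" "separated K1 K3" "separated K3 K1"
  "separated K1 K3b" "separated K3b K1" "separated K1s K2b" "separated K2b K1s"
  "separated K1s K2s" "separated K2s K1s" "separated K2 K3" "separated K3 K2"
  "separated K2b K3b" "separated K3b K2b"
  by (simp_all add: separated_def all_cls join_def)

text \<open>The three claims are the residue pairs 0 and 1, 0 and 2, 1 and 2 of a single path. From
  \<open>b = 4\<close> on, \<open>star_cls\<close> depends only on the parities of \<open>a\<close>
  and \<open>b\<close>, which makes the case split finite.\<close>

lemma separated_star_cls:
  "separated (star_cls a b) (star_cls (Suc a) b)"
  "separated (star_cls a b) (star_cls a (Suc b))"
  "separated (star_cls (Suc a) b) (star_cls a (Suc b))"
proof -
  consider "b = 0" | "b = 1" | "b = 2" | "b = 3" | "b \<ge> 4" by linarith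
  then show "separated (star_cls a b) (star_cls (Suc a) b)"
    by cases (auto simp: star_cls_def)
  consider "b = 0" | "b = 1" | "b = 2" | "b = 3" | "b \<ge> 4" by linarith
  then show "separated (star_cls a b) (star_cls a (Suc b))"
    by cases (auto simp: star_cls_def)
  consider "b = 0" | "b = 1" | "b = 2" | "b = 3" | "b \<ge> 4" by linarith
  then show "separated (star_cls (Suc a) b) (star_cls a (Suc b))"
    by cases (auto simp: star_cls_def)
qed

text \<open>\<open>P\<close> is meant as reachability by a move: the classes listed for \<open>c\<close> suffice to realise every smaller
  value in every bistar with a star of class \<open>c\<close>. \<open>B\<close> flags a star without any path, from which \<open>K2s\<close> cannot be
  reached.\<close>

fun covers :: "(cls \<Rightarrow> bool) \<Rightarrow> bool \<Rightarrow> cls \<Rightarrow> bool" where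
  "covers P B K0 \<longleftrightarrow> True"
| "covers P B K1 \<longleftrightarrow> P K0"
| "covers P B K1s \<longleftrightarrow> P K0 \<and> (P K2s \<or> B)"
| "covers P B K2 \<longleftrightarrow> P K0 \<and> P K1"
| "covers P B K2s \<longleftrightarrow> P K0 \<and> P K1s"
| "covers P B K2b \<longleftrightarrow> P K0 \<and> P K1 \<and> (P K3b \<or> P K1s)"
| "covers P B K3 \<longleftrightarrow> P K0 \<and> P K1 \<and> P K2"
| "covers P B K3b \<longleftrightarrow> P K0 \<and> P K1 \<and> P K2b"

text \<open>The first three hypotheses are the moves that never depend on the actual length: residue
  1 to 0, 2 to 0 and 2 to 1. They leave gaps only at \<open>(0, 0)\<close> and
  \<open>(1, 0)\<close>, where a long path or the deletion of the whole side has to help.\<close>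

lemma covers_star_cls:
  assumes "a > 0 \<Longrightarrow> P (star_cls (a - 1) b)" "b > 0 \<Longrightarrow> P (star_cls a (b - 1))"
    and "b > 0 \<Longrightarrow> P (star_cls (Suc a) (b - 1))"
    and "a = 0 \<Longrightarrow> b = 0 \<Longrightarrow> P K0 \<and> (P K2s \<or> B)" "a = 1 \<Longrightarrow> b = 0 \<Longrightarrow> P K0"
  shows "covers P B (star_cls a b)"
proof -
  consider "b = 0" | "b = 1" | "b = 2" | "b = 3" | "b \<ge> 4" by linarith
  then show ?thesis
  proof cases
    case 1
    consider "a = 0" | "a = 1" | "a = 2" | "a \<ge> 3" by linarith
    then show ?thesis by cases (use 1 assms in \<open>auto simp: star_cls_def split: if_splits\<close>)
  next
    case 2
    consider "a = 0" | "a = 1" | "a = 2" | "a \<ge> 3" by linarith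
    then show ?thesis by cases (use 2 assms in \<open>auto simp: star_cls_def split: if_splits\<close>)
  next
    case 3
    consider "a = 0" | "a = 1" | "a \<ge> 2" by linarith
    then show ?thesis by cases (use 3 assms in \<open>auto simp: star_cls_def split: if_splits\<close>)
  next
    case 4
    consider "a = 0" | "a = 1" | "a \<ge> 2" by linarith
    then show ?thesis by cases (use 4 assms in \<open>auto simp: star_cls_def split: if_splits\<close>)
  next
    case 5
    consider "b = 4" | "b \<ge> 5" "a = 0" | "b \<ge> 5" "a > 0" using 5 by linarith
    then show ?thesis by cases (use 5 assms in \<open>auto simp: star_cls_def split: if_splits\<close>)
  qed
qed

text \<open>A finite check over pairs of classes. The last alternative is two bare centres: value 0
  is then obtained by deleting both at once, a move that belongs to neither side.\<close>

lemma join_less: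
  assumes "covers P B c" "covers Q D d" "v < join c d"
  shows "(\<exists>c'. P c' \<and> join c' d = v) \<or> (\<exists>d'. Q d' \<and> join c d' = v) \<or> (v = 0 \<and> c = K1s \<and> d = K1s \<and> B \<and> D)"
proof -
  have "v < 4" using assms(3) by (cases c; cases d) (simp_all add: join_def)
  then have "v = 0 \<or> v = 1 \<or> v = 2 \<or> v = 3" by linarith
  then show ?thesis using assms
    by (cases c; cases d) (auto simp: join_def ex_cls split: if_splits)
qed


section \<open>Bistars as induced subgraphs of one infinite bistar\<close>

declare split_paired_All [simp del] split_paired_Ex [simp del]

text \<open>A triple consists of the side and the two labels of \<open>Arm\<close>. The label
  \<open>l\<close> is only a name: an arm keeps it when moves shorten it, and the current length is
  kept in a separate function.\<close>

type_synonym arm = "bool \<times> nat \<times> nat"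

definition pt :: "arm \<Rightarrow> nat \<Rightarrow> star_vertex + star_vertex" where
  "pt k i = (case k of (s, l, j) \<Rightarrow> (if s then Inl else Inr) (if i = 0 then Center else Arm l j i))"

definition ctr :: "bool \<Rightarrow> star_vertex + star_vertex" where
  "ctr s = (if s then Inl Center else Inr Center)"

definition adj :: "(star_vertex + star_vertex) rel" where
  "adj = {(pt k i, pt k (Suc i)) | k i. True} \<union> {(pt k (Suc i), pt k i) | k i. True} \<union> {(ctr s, ctr (\<not> s)) | s. True}"

text \<open>Every arm exists, almost always with length 0, and then contributes just the centre.
  Shortening an arm is a function update, and deleting a side changes \<open>A\<close>
  alone.\<close>

definition config :: "bool set \<Rightarrow> (arm \<Rightarrow> nat) \<Rightarrow> (star_vertex + star_vertex) set" where
  "config A f = {pt k i | k i. fst k \<in> A \<and> i \<le> f k}"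

text \<open>The positions are \<open>a + 1\<close> to \<open>b\<close>, so a segment has
  \<open>b - a\<close> vertices and avoids the centre; \<open>segment k 0 (f k)\<close> is a whole
  arm.\<close>

definition segment :: "arm \<Rightarrow> nat \<Rightarrow> nat \<Rightarrow> (star_vertex + star_vertex) set" where
  "segment k a b = (\<lambda>i. pt k (Suc i)) ` {a..<b}"

lemma pt_0 [simp]: "pt k 0 = ctr (fst k)"
  by (auto simp: pt_def ctr_def split: prod.splits)

lemma pt_eq_iff [simp]:
  "pt k (Suc i) = pt k' (Suc i') \<longleftrightarrow> k = k' \<and> i = i'"
  "pt k (Suc i) \<noteq> ctr s" "ctr s \<noteq> pt k (Suc i)" "ctr s = ctr t \<longleftrightarrow> s = t"
  by (auto simp: pt_def ctr_def split: prod.splits if_splits)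

lemma sym_adj: "sym adj"
  by (auto simp: adj_def sym_def)

lemma adj_pt_iff: "(pt k (Suc i), y) \<in> adj \<longleftrightarrow> y = pt k i \<or> y = pt k (Suc (Suc i))"
proof
  assume "(pt k (Suc i), y) \<in> adj"
  then consider k' i' where "pt k (Suc i) = pt k' i'" "y = pt k' (Suc i')"
    | k' i' where "pt k (Suc i) = pt k' (Suc i')" "y = pt k' i'" unfolding adj_def by auto
  then show "y = pt k i \<or> y = pt k (Suc (Suc i))"
  proof cases
    case 1
    then show ?thesis by (cases i') auto
  qed auto
qed (auto simp: adj_def)

lemma adj_ctr_iff: "(ctr s, y) \<in> adj \<longleftrightarrow> y = ctr (\<not> s) \<or> (\<exists>k. fst k = s \<and> y = pt k (Suc 0))"
proof
  assume "(ctr s, y) \<in> adj"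
  then consider k i where "ctr s = pt k i" "y = pt k (Suc i)" | "y = ctr (\<not> s)"
    unfolding adj_def by auto
  then show "y = ctr (\<not> s) \<or> (\<exists>k. fst k = s \<and> y = pt k (Suc 0))"
  proof cases
    case 1
    then show ?thesis by (cases i) auto
  qed auto
next
  have "(pt k 0, pt k (Suc 0)) \<in> adj" for k unfolding adj_def by blast
  then show "(ctr s, y) \<in> adj" if "y = ctr (\<not> s) \<or> (\<exists>k. fst k = s \<and> y = pt k (Suc 0))"
    using that by (auto simp: adj_def)
qed

lemma pt_in_config [simp]:
  "pt k (Suc i) \<in> config A f \<longleftrightarrow> fst k \<in> A \<and> i < f k" "ctr s \<in> config A f \<longleftrightarrow> s \<in> A"
proof -
  show "pt k (Suc i) \<in> config A f \<longleftrightarrow> fst k \<in> A \<and> i < f k"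
  proof
    assume "pt k (Suc i) \<in> config A f"
    then obtain k' i' where "pt k (Suc i) = pt k' i'" "fst k' \<in> A" "i' \<le> f k'"
      unfolding config_def by blast
    then show "fst k \<in> A \<and> i < f k" by (cases i') auto
  next
    assume "fst k \<in> A \<and> i < f k"
    then have "fst k \<in> A" "Suc i \<le> f k" by auto
    then show "pt k (Suc i) \<in> config A f" unfolding config_def by blast
  qed
  show "ctr s \<in> config A f \<longleftrightarrow> s \<in> A"
  proof
    assume "ctr s \<in> config A f"
    then obtain k' i' where "ctr s = pt k' i'" "fst k' \<in> A" "i' \<le> f k'"
      unfolding config_def by blast
    then show "s \<in> A" by (cases i') auto
  next
    assume "s \<in> A"
    moreover have "ctr s = pt (s, 0, 0) 0" by simp
    ultimately show "ctr s \<in> config A f" unfolding config_def by fastforce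
  qed
qed

lemma config_cases:
  assumes "x \<in> config A f"
  obtains (ctr) s where "x = ctr s" "s \<in> A" | (pt) k i where "x = pt k (Suc i)" "fst k \<in> A" "i < f k"
proof -
  obtain k i where "x = pt k i" "fst k \<in> A" "i \<le> f k" using assms unfolding config_def by blast
  then show ?thesis using that by (cases i) auto
qed

lemma pt_in_segment [simp]:
  "pt k' (Suc i) \<in> segment k a b \<longleftrightarrow> k' = k \<and> a \<le> i \<and> i < b" "ctr s \<notin> segment k a b"
  by (auto simp: segment_def)

lemma segment_cases:
  assumes "x \<in> segment k a b"
  obtains i where "x = pt k (Suc i)" "a \<le> i" "i < b"
  using assms by (auto simp: segment_def)

lemma segment_empty [simp]: "b \<le> a \<Longrightarrow> segment k a b = {}"
  by (auto simp: segment_def)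

lemma finite_segment [simp]: "finite (segment k a b)"
  by (simp add: segment_def)

lemma config_empty [simp]: "config {} f = {}"
  by (auto simp: config_def)

lemma finite_config:
  assumes "finite {k. f k \<noteq> 0}"
  shows "finite (config A f)"
proof -
  have "config A f \<subseteq> range ctr \<union> (\<Union>k\<in>{k. f k \<noteq> 0}. pt k ` {..f k})"
  proof
    fix x assume "x \<in> config A f"
    then show "x \<in> range ctr \<union> (\<Union>k\<in>{k. f k \<noteq> 0}. pt k ` {..f k})"
      by (cases rule: config_cases) (auto intro!: exI imageI)
  qed
  then show ?thesis by (rule finite_subset) (use assms in auto)
qed

lemma conn_config:
  assumes "A \<noteq> {}"
  shows "conn adj (config A f)"
proof -
  obtain s where s: "s \<in> A" using assms by blast
  let ?D = "adj \<inter> config A f \<times> config A f"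
  have c: "(ctr t, ctr s) \<in> ?D\<^sup>*" if "t \<in> A" for t
    using that s by (cases "t = s") (auto simp: adj_ctr_iff intro!: r_into_rtrancl)
  have p: "(pt k i, ctr s) \<in> ?D\<^sup>*" if "fst k \<in> A" "i \<le> f k" for k i
    using that
  proof (induction i)
    case (Suc i)
    have "pt k i \<in> config A f" using Suc.prems unfolding config_def by fastforce
    then have "(pt k (Suc i), pt k i) \<in> ?D" using Suc.prems by (auto simp: adj_pt_iff)
    then show ?case using Suc by (meson Suc_leD converse_rtrancl_into_rtrancl)
  qed (simp add: c)
  show ?thesis
  proof (rule connI[OF sym_adj, of "ctr s"])
    show "ctr s \<in> config A f" using s by simp
    fix x assume "x \<in> config A f"
    then obtain k i where "x = pt k i" "fst k \<in> A" "i \<le> f k" unfolding config_def by blast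
    then show "(x, ctr s) \<in> ?D\<^sup>*" using p by blast
  qed
qed

lemma conn_segment:
  assumes "a < b"
  shows "conn adj (segment k a b)"
proof -
  let ?D = "adj \<inter> segment k a b \<times> segment k a b"
  have p: "a + i < b \<longrightarrow> (pt k (Suc (a + i)), pt k (Suc a)) \<in> ?D\<^sup>*" for i
  proof (induction i)
    case (Suc i)
    show ?case
    proof
      assume i: "a + Suc i < b"
      then have "(pt k (Suc (a + Suc i)), pt k (Suc (a + i))) \<in> ?D" by (auto simp: adj_pt_iff simp del: pt_eq_iff)
      then show "(pt k (Suc (a + Suc i)), pt k (Suc a)) \<in> ?D\<^sup>*"
        using Suc i by (auto intro: converse_rtrancl_into_rtrancl)
    qed
  qed simp
  show ?thesis
  proof (rule connI[OF sym_adj, of "pt k (Suc a)"])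
    fix x assume "x \<in> segment k a b"
    then show "(x, pt k (Suc a)) \<in> ?D\<^sup>*"
      by (cases rule: segment_cases) (use p le_Suc_ex in blast)
  qed (use assms in simp)
qed

text \<open>Positions \<open>a\<close> and \<open>b + 1\<close> are the only neighbours outside the
  segment. When both are missing from \<open>R\<close>, no edge of \<open>R\<close> leaves
  it.\<close>

lemma conn_eq_segment:
  assumes "conn adj R" "a < b" "segment k a b \<subseteq> R" "pt k a \<notin> R" "pt k (Suc b) \<notin> R"
  shows "R = segment k a b"
proof (rule conn_closed_subset[OF assms(1,3)])
  show "segment k a b \<noteq> {}" using assms(2) by (auto simp: segment_def)
next
  fix x y assume "x \<in> segment k a b" "y \<in> R" "(x, y) \<in> adj"
  then obtain i where i: "x = pt k (Suc i)" "a \<le> i" "i < b" "y = pt k i \<or> y = pt k (Suc (Suc i))" "y \<in> R"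
    by (metis adj_pt_iff segment_cases)
  then show "y \<in> segment k a b"
  proof (elim disjE)
    assume y: "y = pt k i"
    then have "i \<noteq> a" using i assms(4) by auto
    then obtain j where "i = Suc j" "a \<le> j" using i(2) by (cases i) auto
    then show ?thesis using i y by simp
  next
    assume y: "y = pt k (Suc (Suc i))"
    then have "Suc i \<noteq> b" using i assms(5) by auto
    then show ?thesis using i y by simp
  qed
qed

text \<open>Edges join consecutive positions of one arm or the two centres. As position 0 of an arm
  is its centre, the first edge of an arm forms a case of its own.\<close>

lemma pair_cases:
  assumes "u \<in> config A f" "v \<in> config A f" "u = v \<or> (u, v) \<in> adj"
  obtains (arm) k m n where "{u, v} = segment k m n" "m < n" "n \<le> m + 2" "n \<le> f k" "fst k \<in> A"
  | (ctr) s where "{u, v} = {ctr s}" "s \<in> A"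
  | (ctr_pt) k where "{u, v} = {ctr (fst k), pt k (Suc 0)}" "0 < f k" "fst k \<in> A"
  | (ctrs) "{u, v} = {ctr True, ctr False}" "A = UNIV"
  using assms(1)
proof (cases rule: config_cases)
  case (ctr s)
  then consider "v = u" | "v = ctr (\<not> s)" | k where "fst k = s" "v = pt k (Suc 0)"
    using assms(3) by (auto simp: adj_ctr_iff)
  then show ?thesis
  proof cases
    case 1
    then show ?thesis using ctr that(2) by auto
  next
    case 2
    then have "A = UNIV" using ctr assms(2) by (cases s) (auto simp: UNIV_bool)
    moreover have "{u, v} = {ctr True, ctr False}" using 2 ctr by (cases s) auto
    ultimately show ?thesis by (rule that(4)[rotated])
  next
    case 3
    then show ?thesis using ctr assms(2) that(3)[of k] by auto
  qed
next
  case (pt k i)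
  have seg: "segment k a (Suc a) = {pt k (Suc a)}" "segment k a (Suc (Suc a)) = {pt k (Suc a), pt k (Suc (Suc a))}" for a
    by (auto simp: less_Suc_eq elim!: segment_cases)
  consider "v = u" | "v = pt k i" | "v = pt k (Suc (Suc i))"
    using assms(3) pt by (auto simp: adj_pt_iff)
  then show ?thesis
  proof cases
    case 1
    then show ?thesis using pt that(1)[of k i "Suc i"] by (simp add: seg)
  next
    case 2
    show ?thesis
    proof (cases i)
      case 0
      then show ?thesis using 2 pt that(3)[of k] by auto
    next
      case (Suc j)
      then show ?thesis using 2 pt that(1)[of k j "Suc i"] by (auto simp: seg)
    qed
  next
    case 3
    then show ?thesis using pt assms(2) that(1)[of k i "Suc (Suc i)"] by (simp add: seg)
  qed
qed

section \<open>Paths as a subtraction game\<close>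

lemma removals_segment:
  assumes "R \<in> removals adj (segment k a b)"
  obtains m n where "a \<le> m" "m < n" "n \<le> b" "n \<le> m + 2" "m = a \<and> R = segment k n b \<or> n = b \<and> R = segment k a m"
proof -
  obtain u v where uv: "u \<in> segment k a b" "v \<in> segment k a b" "u = v \<or> (u, v) \<in> adj"
      "R = segment k a b - {u, v}" "R = {} \<or> conn adj R"
    using assms unfolding removals_def by blast
  \<comment> \<open>Any configuration containing the segment would serve; it makes
    \<open>pair_cases\<close> applicable.\<close>
  have sub: "segment k a b \<subseteq> config UNIV (\<lambda>_. b)" by (auto elim!: segment_cases)
  have nc: "ctr s \<notin> {u, v}" for s using uv(1,2) by auto
  obtain k' m n where seg: "{u, v} = segment k' m n" and mn: "m < n" "n \<le> m + 2"
    using subsetD[OF sub uv(1)] subsetD[OF sub uv(2)] uv(3)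
  proof (cases rule: pair_cases)
    case (ctr s)
    then show ?thesis using nc[of s] by simp
  next
    case (ctr_pt k)
    then show ?thesis using nc[of "fst k"] by simp
  next
    case ctrs
    then show ?thesis using nc[of True] by simp
  qed
  obtain n' where n': "n = Suc n'" using mn by (cases n) auto
  have "pt k' (Suc m) \<in> {u, v}" "pt k' (Suc n') \<in> {u, v}"
    unfolding seg using mn n' by auto
  moreover have "{u, v} \<subseteq> segment k a b" using uv(1,2) by simp
  ultimately have "pt k' (Suc m) \<in> segment k a b" "pt k' (Suc n') \<in> segment k a b"
    by (simp_all only: subsetD)
  then have k': "k' = k" and b: "a \<le> m" "n \<le> b" using n' by auto
  have R: "R = segment k a b - segment k m n" using uv(4) seg k' by simp
  have "m = a \<and> R = segment k n b \<or> n = b \<and> R = segment k a m"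
  proof (cases "n = b")
    case True
    then show ?thesis unfolding R using mn b by (auto elim!: segment_cases)
  next
    case False
    have "R = segment k n b"
    proof (rule conn_eq_segment)
      show "n < b" using False b by simp
      then have "pt k (Suc n) \<in> R" unfolding R using mn b by simp
      then show "conn adj R" using uv(5) by auto
      show "segment k n b \<subseteq> R" unfolding R using mn b by (auto elim!: segment_cases)
      show "pt k n \<notin> R" "pt k (Suc b) \<notin> R" unfolding R n' using mn b n' by auto
    qed
    moreover have "pt k (Suc a) \<in> R" if "m \<noteq> a" unfolding R using mn b that by auto
    ultimately show ?thesis using mn b by auto
  qed
  then show ?thesis using that mn b by blast
qed

lemma mod3_neq: "m < n \<Longrightarrow> n \<le> m + 2 \<Longrightarrow> m mod 3 \<noteq> n mod (3::nat)"
  by presburger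

lemma mod3_lower:
  assumes "v < n mod (3::nat)"
  obtains m where "m < n" "n \<le> m + 2" "m mod 3 = v"
proof -
  have "n mod 3 < 3" by simp
  then have "n mod 3 - v \<le> 2" by linarith
  moreover have "n mod 3 \<le> n" by simp
  moreover have "(n div 3 * 3 + v) mod 3 = v" using assms by simp
  moreover have "n = n div 3 * 3 + n mod 3" by simp
  \<comment> \<open>The witness is \<open>n\<close> with its residue lowered to \<open>v\<close>
    inside the same block of three consecutive numbers, hence at most 2 below
    \<open>n\<close>.\<close>
  ultimately show ?thesis using assms by (intro that[of "n div 3 * 3 + v"]) linarith+
qed

text \<open>Deleting interior vertices of a path disconnects it, so only 1 or 2 vertices at an end
  can go: the subtraction game with set {1, 2}, whose values have period 3.\<close>

lemma gr_segment: "gr adj (segment k a b) = (b - a) mod 3"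
proof (induction "b - a" arbitrary: a b rule: less_induct)
  case less
  show ?case
  proof (cases "a < b")
    case True
    \<comment> \<open>Deletions at the outer end alone already realise every smaller value.\<close>
    have rem: "segment k a m \<in> removals adj (segment k a b)" if "a \<le> m" "m < b" "b \<le> m + 2" for m
    proof -
      obtain n where n: "b = Suc n" using True by (cases b) auto
      have "segment k a m = segment k a b - {pt k (Suc m), pt k b}"
      proof -
        have "m = n \<or> n = Suc m" using that n by auto
        then show ?thesis unfolding n by (auto elim!: segment_cases)
      qed
      moreover have "Suc m = b \<or> b = Suc (Suc m)" using that by auto
      then have "pt k (Suc m) = pt k b \<or> (pt k (Suc m), pt k b) \<in> adj" by (auto simp: adj_pt_iff)
      moreover have "segment k a m = {} \<or> conn adj (segment k a m)"
        using conn_segment[of a m k] by (cases "a < m") auto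
      moreover have "pt k (Suc m) \<in> segment k a b" "pt k b \<in> segment k a b" using that n by auto
      ultimately show ?thesis unfolding removals_def by blast
    qed
    have "gr adj (segment k a b) = mex (gr adj ` removals adj (segment k a b))"
      by (rule gr_conn[OF sym_adj finite_segment conn_segment[OF True]])
    also have "\<dots> = (b - a) mod 3"
    proof (rule mex_eqI)
      show "(b - a) mod 3 \<notin> gr adj ` removals adj (segment k a b)"
      proof
        assume "(b - a) mod 3 \<in> gr adj ` removals adj (segment k a b)"
        then obtain R where R: "R \<in> removals adj (segment k a b)" "gr adj R = (b - a) mod 3" by auto
        obtain m n where mn: "a \<le> m" "m < n" "n \<le> b" "n \<le> m + 2"
            "m = a \<and> R = segment k n b \<or> n = b \<and> R = segment k a m"
          using R(1) by (rule removals_segment)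
        obtain c where "c < b - a" "b - a \<le> c + 2" "gr adj R = c mod 3"
          using mn(5)
        proof (elim disjE conjE)
          assume "m = a" "R = segment k n b"
          moreover from this have "gr adj R = (b - n) mod 3" using mn(1-3) by (simp add: less.hyps)
          ultimately show ?thesis using that[of "b - n"] mn(1-4) by simp
        next
          assume "n = b" "R = segment k a m"
          moreover from this have "gr adj R = (m - a) mod 3" using mn(1-3) less.hyps[of m a] True by simp
          ultimately show ?thesis using that[of "m - a"] mn(1-4) by simp
        qed
        then show False using R(2) mod3_neq by metis
      qed
    next
      fix v assume "v < (b - a) mod 3"
      then obtain c where c: "c < b - a" "b - a \<le> c + 2" "c mod 3 = v" by (rule mod3_lower)
      have "gr adj (segment k a (a + c)) = v" using less.hyps[of "a + c" a] c by simp
      moreover have "segment k a (a + c) \<in> removals adj (segment k a b)" using c by (intro rem) auto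
      ultimately show "v \<in> gr adj ` removals adj (segment k a b)" by blast
    qed
    finally show ?thesis .
  qed simp
qed


section \<open>Moves in bistars\<close>

text \<open>An outer piece of an arm that gets detached must be everything that is left. Hence a
  deletion within an arm takes its outer end, and a deletion that includes a centre leaves either
  the configuration without that side or a single arm, possibly reduced to nothing.\<close>

lemma removals_config:
  assumes "R \<in> removals adj (config A f)"
  obtains (arm) k m where "fst k \<in> A" "m < f k" "f k \<le> m + 2" "R = config A (f(k := m))"
  | (side) s where "s \<in> A" "R = config (A - {s}) f"
      "(\<forall>k. fst k = s \<longrightarrow> f k = 0) \<or> (\<exists>k. fst k = s \<and> f k = 1 \<and> (\<forall>k'. fst k' = s \<longrightarrow> k' \<noteq> k \<longrightarrow> f k' = 0))"
  | (path) k a where "R = segment k a (f k)" "A = {fst k}" "a < f k" "a \<le> 1"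
      "\<forall>k'. fst k' = fst k \<longrightarrow> k' \<noteq> k \<longrightarrow> f k' = 0"
  | (path2) k k' where "R = segment k 0 (f k)" "A = {fst k}" "k' \<noteq> k" "fst k' = fst k" "f k' = 1"
      "\<forall>k''. fst k'' = fst k \<longrightarrow> k'' \<noteq> k \<longrightarrow> k'' \<noteq> k' \<longrightarrow> f k'' = 0"
  | (ctrs) k where "R = segment k 0 (f k)" "A = UNIV" "\<forall>k'. k' \<noteq> k \<longrightarrow> f k' = 0"
proof -
  let ?W = "config A f"
  obtain u v where uv: "u \<in> ?W" "v \<in> ?W" "u = v \<or> (u, v) \<in> adj"
      "R = ?W - {u, v}" "R = {} \<or> conn adj R"
    using assms unfolding removals_def by blast
  \<comment> \<open>If position \<open>n\<close> is deleted and nothing beyond it, the part beyond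
    is separated from all other vertices and so is the whole remainder.\<close>
  have cut: "R = segment k n (f k)" if "fst k \<in> A" "n < f k" "pt k n \<in> {u, v}" "\<And>i. n \<le> i \<Longrightarrow> pt k (Suc i) \<notin> {u, v}" for k n
  proof (rule conn_eq_segment)
    have "pt k (Suc n) \<in> R" using that unfolding uv(4) by simp
    then show "conn adj R" using uv(5) by auto
    show "segment k n (f k) \<subseteq> R" unfolding uv(4) using that(1,4) by (auto elim!: segment_cases simp del: insert_iff)
  qed (use that in \<open>auto simp: uv(4)\<close>)
  \<comment> \<open>Once the remainder is a segment, any other nonempty arm must have lost its first
    vertex; the next fact is the analogue for the opposite centre.\<close>
  have zero: "f k' = 0" if "R = segment k n m" "fst k' \<in> A" "k' \<noteq> k" "pt k' (Suc 0) \<notin> {u, v}" for k k' n m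
  proof (rule ccontr)
    assume "f k' \<noteq> 0"
    then have "pt k' (Suc 0) \<in> R" by (subst uv(4)) (use that(2,4) in simp)
    then show False using that by simp
  qed
  have single: "A = {t}" if "R = segment k n m" "t \<in> A" "ctr (\<not> t) \<notin> {u, v}" for k n m t
  proof -
    have "(\<not> t) \<notin> A"
    proof
      assume "(\<not> t) \<in> A"
      then have "ctr (\<not> t) \<in> R" by (subst uv(4)) (use that(3) in simp)
      then show False using that by simp
    qed
    then show ?thesis using that(2) by (cases t) (auto, (metis (full_types))+)
  qed
  from uv(1-3) show ?thesis
  proof (cases rule: pair_cases)
    case (arm k m n)
    obtain n' where n': "n = Suc n'" using arm by (cases n) auto
    have nc: "ctr s \<notin> {u, v}" for s unfolding arm(1) by simp
    \<comment> \<open>Otherwise the tail of the arm would be cut off while the centre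
      survives.\<close>
    have "n = f k"
    proof (rule ccontr)
      assume "n \<noteq> f k"
      then have "R = segment k n (f k)" using arm n' by (intro cut) (auto simp del: insert_iff)
      moreover have "ctr (fst k) \<in> R" unfolding uv(4) using arm(5) nc by simp
      ultimately show False by simp
    qed
    have "R = config A (f(k := m))"
    proof (intro equalityI subsetI)
      fix x assume "x \<in> R"
      then have x: "x \<in> ?W" "x \<notin> segment k m n" unfolding uv(4) arm(1) by auto
      from x(1) show "x \<in> config A (f(k := m))"
        by (cases rule: config_cases) (use x(2) \<open>n = f k\<close> in auto)
    next
      fix x assume "x \<in> config A (f(k := m))"
      then show "x \<in> R" unfolding uv(4) arm(1)
        by (cases rule: config_cases) (use arm(2,4) in \<open>auto split: if_splits\<close>)
    qed
    then show ?thesis using arm \<open>n = f k\<close> that(1)[of k m] by simp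
  next
    case (ctr s)
    show ?thesis
    proof (cases "\<exists>k. fst k = s \<and> f k \<noteq> 0")
      case True
      then obtain k where k: "fst k = s" "f k \<noteq> 0" by blast
      have R: "R = segment k 0 (f k)" using k ctr by (intro cut) (auto simp del: insert_iff)
      show ?thesis
      proof (rule that(3)[OF R])
        show "A = {fst k}" using single[OF R, of s] ctr k by simp
        show "\<forall>k'. fst k' = fst k \<longrightarrow> k' \<noteq> k \<longrightarrow> f k' = 0" using zero[OF R] ctr k by simp
      qed (use k in auto)
    next
      case False
      have "R = config (A - {s}) f"
      proof (intro equalityI subsetI)
        fix x assume "x \<in> R"
        then have x: "x \<in> ?W" "x \<noteq> ctr s" unfolding uv(4) ctr(1) by auto
        from x(1) show "x \<in> config (A - {s}) f"
          by (cases rule: config_cases) (use x(2) False in auto)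
      next
        fix x assume "x \<in> config (A - {s}) f"
        then show "x \<in> R" unfolding uv(4) ctr(1) by (cases rule: config_cases) auto
      qed
      then show ?thesis using ctr False that(2)[of s] by blast
    qed
  next
    case (ctr_pt k)
    show ?thesis
    proof (cases "f k = 1")
      case False
      have R: "R = segment k 1 (f k)" using ctr_pt False by (intro cut) (auto simp del: insert_iff simp: insert_iff[of _ _ "{_}"] )
      show ?thesis
      proof (rule that(3)[OF R])
        show "A = {fst k}" using single[OF R, of "fst k"] ctr_pt by simp
        show "\<forall>k'. fst k' = fst k \<longrightarrow> k' \<noteq> k \<longrightarrow> f k' = 0" using zero[OF R] ctr_pt by simp
      qed (use ctr_pt False in auto)
    next
      case f: True
      show ?thesis
      proof (cases "\<exists>k'. fst k' = fst k \<and> k' \<noteq> k \<and> f k' \<noteq> 0")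
        case True
        then obtain k' where k': "fst k' = fst k" "k' \<noteq> k" "f k' \<noteq> 0" by blast
        have R: "R = segment k' 0 (f k')" by (rule cut) (use ctr_pt k' in auto)
        show ?thesis
        proof (rule that(4)[OF R])
          show "A = {fst k'}" using single[OF R, of "fst k"] ctr_pt k' by simp
          show "\<forall>k''. fst k'' = fst k' \<longrightarrow> k'' \<noteq> k' \<longrightarrow> k'' \<noteq> k \<longrightarrow> f k'' = 0"
            using zero[OF R] ctr_pt k' by simp
        qed (use k' f in auto)
      next
        case False
        have "R = config (A - {fst k}) f"
        proof (intro equalityI subsetI)
          fix x assume "x \<in> R"
          then have x: "x \<in> ?W" "x \<noteq> ctr (fst k)" "x \<noteq> pt k (Suc 0)" unfolding uv(4) ctr_pt(1) by auto
          from x(1) show "x \<in> config (A - {fst k}) f"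
          proof (cases rule: config_cases)
            case (pt k' i)
            have "fst k' \<noteq> fst k"
            proof
              assume "fst k' = fst k"
              then have "k' = k" using False pt by auto
              then show False using pt x f by auto
            qed
            then show ?thesis using pt by simp
          qed (use x(2) in auto)
        next
          fix x assume "x \<in> config (A - {fst k}) f"
          then show "x \<in> R" unfolding uv(4) ctr_pt(1) by (cases rule: config_cases) auto
        qed
        then show ?thesis using ctr_pt False f that(2)[of "fst k"] by blast
      qed
    qed
  next
    case ctrs
    have c: "ctr s \<in> {u, v}" for s unfolding ctrs(1) by (cases s) auto
    have p: "pt k (Suc i) \<notin> {u, v}" for k i unfolding ctrs(1) by simp
    show ?thesis
    proof (cases "\<exists>k. f k \<noteq> 0")
      case True
      then obtain k where k: "f k \<noteq> 0" by blast
      have R: "R = segment k 0 (f k)" using k ctrs c p by (intro cut) (auto simp del: insert_iff)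
      show ?thesis using that(5)[OF R] zero[OF R] ctrs p by blast
    next
      case False
      have "R = {}"
      proof -
        have "x \<notin> R" for x
        proof
          assume "x \<in> R"
          then have x: "x \<in> ?W" "x \<notin> {u, v}" unfolding uv(4) by auto
          from x(1) show False by (cases rule: config_cases) (use x(2) c False in \<open>auto simp del: insert_iff\<close>)
        qed
        then show ?thesis by blast
      qed
      \<comment> \<open>All arms have length 0, so any arm represents the empty remainder.\<close>
      then have "R = segment undefined 0 (f undefined)" using False by simp
      then show ?thesis using that(5) ctrs False by blast
    qed
  qed
qed

section \<open>Moves available for realising smaller values\<close>

lemma arm_removal:
  assumes "fst k \<in> A" "m < f k" "f k \<le> m + 2"
  shows "config A (f(k := m)) \<in> removals adj (config A f)"
proof -
  obtain n where n: "f k = Suc n" using assms by (cases "f k") auto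
  have mn: "n = m \<or> n = Suc m" using assms n by auto
  have "config A (f(k := m)) = config A f - {pt k (Suc m), pt k (Suc n)}"
  proof (intro equalityI subsetI)
    fix x assume "x \<in> config A f - {pt k (Suc m), pt k (Suc n)}"
    then have x: "x \<in> config A f" "x \<noteq> pt k (Suc m)" "x \<noteq> pt k (Suc n)" by auto
    from x(1) show "x \<in> config A (f(k := m))"
    proof (cases rule: config_cases)
      case (pt k' i)
      then show ?thesis using x(2,3) mn n by (cases "k' = k") auto
    qed simp
  next
    fix x assume "x \<in> config A (f(k := m))"
    then show "x \<in> config A f - {pt k (Suc m), pt k (Suc n)}"
    proof (cases rule: config_cases)
      case (pt k' i)
      then show ?thesis using mn n by (cases "k' = k") auto
    qed simp
  qed
  moreover have "conn adj (config A (f(k := m)))" using assms by (intro conn_config) auto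
  moreover have "pt k (Suc m) = pt k (Suc n) \<or> (pt k (Suc m), pt k (Suc n)) \<in> adj"
    using mn by (auto simp: adj_pt_iff)
  moreover have "pt k (Suc m) \<in> config A f" "pt k (Suc n) \<in> config A f" using assms n by auto
  ultimately show ?thesis unfolding removals_def by blast
qed

lemma side_removal:
  assumes "s \<in> A"
    and "(\<forall>k. fst k = s \<longrightarrow> f k = 0) \<or> (\<exists>k. fst k = s \<and> f k = 1 \<and> (\<forall>k'. fst k' = s \<longrightarrow> k' \<noteq> k \<longrightarrow> f k' = 0))"
  shows "config (A - {s}) f \<in> removals adj (config A f)"
proof -
  obtain v where v: "v \<in> config A f" "ctr s = v \<or> (ctr s, v) \<in> adj" "config (A - {s}) f = config A f - {ctr s, v}"
    using assms(2)
  proof (elim disjE exE conjE)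
    assume z: "\<forall>k. fst k = s \<longrightarrow> f k = 0"
    have "config (A - {s}) f = config A f - {ctr s, ctr s}"
      by (auto elim!: config_cases simp: z)
    then show ?thesis using that[of "ctr s"] assms(1) by simp
  next
    fix k assume k: "fst k = s" "f k = 1" "\<forall>k'. fst k' = s \<longrightarrow> k' \<noteq> k \<longrightarrow> f k' = 0"
    have "config (A - {s}) f = config A f - {ctr s, pt k (Suc 0)}"
    proof (intro equalityI subsetI)
      fix x assume "x \<in> config A f - {ctr s, pt k (Suc 0)}"
      then have x: "x \<in> config A f" "x \<noteq> ctr s" "x \<noteq> pt k (Suc 0)" by auto
      from x(1) show "x \<in> config (A - {s}) f"
      proof (cases rule: config_cases)
        case (pt k' i)
        then show ?thesis using x k by (cases "k' = k") auto
      qed (use x in simp)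
    next
      fix x assume "x \<in> config (A - {s}) f"
      then show "x \<in> config A f - {ctr s, pt k (Suc 0)}"
        by (cases rule: config_cases) (use k in auto)
    qed
    then show ?thesis using that[of "pt k (Suc 0)"] assms(1) k by (auto simp: adj_ctr_iff)
  qed
  moreover have "config (A - {s}) f = {} \<or> conn adj (config (A - {s}) f)"
    using conn_config[of "A - {s}" f] by (cases "A - {s} = {}") (simp_all only: config_empty simp_thms)
  moreover have "ctr s \<in> config A f" using assms(1) by simp
  ultimately show ?thesis unfolding removals_def by blast
qed

lemma ctrs_removal:
  assumes "\<And>k. f k = 0"
  shows "{} \<in> removals adj (config UNIV f)"
proof -
  have "config UNIV f - {ctr True, ctr False} = {}"
  proof -
    have "x \<in> {ctr True, ctr False}" if "x \<in> config UNIV f" for x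
      using that
    proof (cases rule: config_cases)
      case (ctr s)
      then show ?thesis by (cases s) auto
    qed (use assms in simp)
    then show ?thesis by blast
  qed
  moreover have "(ctr True, ctr False) \<in> adj" "ctr True \<in> config UNIV f" "ctr False \<in> config UNIV f"
    by (auto simp: adj_ctr_iff)
  ultimately show ?thesis unfolding removals_def by blast
qed


section \<open>Grundy values of bistars\<close>

text \<open>Meaningful for residues 1 and 2: with finite support almost all arms have length 0, so
  the set for residue 0 is infinite. Hence the condition \<open>r > 0\<close> in the lemmas
  below.\<close>

definition cnt :: "(arm \<Rightarrow> nat) \<Rightarrow> bool \<Rightarrow> nat \<Rightarrow> nat" where
  "cnt f s r = card {k. fst k = s \<and> f k mod 3 = r}"

definition side_cls :: "bool set \<Rightarrow> (arm \<Rightarrow> nat) \<Rightarrow> bool \<Rightarrow> cls" where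
  "side_cls A f s = (if s \<in> A then star_cls (cnt f s 1) (cnt f s 2) else K0)"

text \<open>Splits off the arm a move acts on: \<open>a\<close> and \<open>b\<close> count the
  remaining arms, so the classes before and after the move differ only in \<open>n\<close>.\<close>

definition add_arm :: "nat \<Rightarrow> nat \<Rightarrow> nat \<Rightarrow> cls" where
  "add_arm a b n = star_cls (a + of_bool (n mod 3 = 1)) (b + of_bool (n mod 3 = 2))"

lemma separated_add_arm:
  assumes "m mod 3 \<noteq> n mod (3::nat)"
  shows "separated (add_arm a b m) (add_arm a b n)"
proof -
  have "m mod 3 = 0 \<or> m mod 3 = 1 \<or> m mod 3 = 2" "n mod 3 = 0 \<or> n mod 3 = 1 \<or> n mod 3 = 2" by auto
  then show ?thesis
    using assms separated_star_cls[of a b] separated_star_cls[of a b, THEN separated_sym]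
    by (elim disjE) (simp_all add: add_arm_def)
qed

lemma finite_residue:
  assumes "finite {k. f k \<noteq> 0}" "r > 0"
  shows "finite {k. fst k = s \<and> f k mod 3 = (r::nat)}"
  by (rule finite_subset[OF _ assms(1)]) (use assms(2) in auto)

lemma finite_support_upd:
  "finite {k. f k \<noteq> (0::nat)} \<Longrightarrow> finite {k'. (f(k := m)) k' \<noteq> 0}"
  by (rule finite_subset[of _ "insert k {k. f k \<noteq> 0}"]) auto

lemma cnt_upd:
  assumes "finite {k. f k \<noteq> 0}" "r > 0"
  shows "cnt (f(k := m)) s r = cnt (f(k := 0)) s r + of_bool (fst k = s \<and> m mod 3 = r)"
proof -
  let ?N = "{k'. fst k' = s \<and> (f(k := 0)) k' mod 3 = r}"
  have fin: "finite ?N" by (rule finite_residue[OF finite_support_upd[OF assms(1)] assms(2)])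
  have k: "k \<notin> ?N" using assms(2) by simp
  have "{k'. fst k' = s \<and> (f(k := m)) k' mod 3 = r} = (if fst k = s \<and> m mod 3 = r then insert k ?N else ?N)"
    using assms(2) by auto
  then have "cnt (f(k := m)) s r = (if fst k = s \<and> m mod 3 = r then card (insert k ?N) else card ?N)"
    unfolding cnt_def by (auto simp only: split: if_splits)
  then show ?thesis unfolding card_insert_disjoint[OF fin k] cnt_def by (simp del: fun_upd_apply)
qed

lemma cnt_split:
  assumes "finite {k. f k \<noteq> 0}" "r > 0"
  shows "cnt f s r = cnt (f(k := 0)) s r + of_bool (fst k = s \<and> f k mod 3 = r)"
  using cnt_upd[OF assms, of k "f k" s] by simp

lemma cnt_zero:
  assumes "r > 0" "\<And>k. fst k = s \<Longrightarrow> f k = 0"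
  shows "cnt f s r = 0"
proof -
  have "\<not> (fst k = s \<and> f k mod 3 = r)" for k using assms(2)[of k] assms(1) by fastforce
  then show ?thesis unfolding cnt_def by (subst Collect_empty_eq[THEN iffD2]) auto
qed

lemma side_cls_upd:
  assumes "finite {k. f k \<noteq> 0}"
  shows "side_cls A (f(k := m)) s =
    (if s \<in> A \<and> fst k = s then add_arm (cnt (f(k := 0)) s 1) (cnt (f(k := 0)) s 2) m else side_cls A f s)"
  using cnt_upd[OF assms, of _ k m s] cnt_split[OF assms, of _ s k] by (simp add: side_cls_def add_arm_def)

lemma side_cls_zero:
  assumes "s \<in> A" "\<And>k. fst k = s \<Longrightarrow> f k = 0"
  shows "side_cls A f s = K1s"
  using assms by (simp add: side_cls_def cnt_zero star_cls_def)

lemma side_cls_single: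
  assumes "finite {k. f k \<noteq> 0}" "fst k \<in> A" "\<And>k'. fst k' = fst k \<Longrightarrow> k' \<noteq> k \<Longrightarrow> f k' = 0"
  shows "side_cls A f (fst k) = add_arm 0 0 (f k)"
proof -
  have "cnt (f(k := 0)) (fst k) r = 0" if "r > 0" for r
    by (rule cnt_zero[OF that]) (use assms(3) in auto)
  then show ?thesis using side_cls_upd[OF assms(1), of A k "f k" "fst k"] assms(2) by simp
qed

abbreviation bi_val :: "bool set \<Rightarrow> (arm \<Rightarrow> nat) \<Rightarrow> nat" where
  "bi_val A f \<equiv> join (side_cls A f True) (side_cls A f False)"

lemma bi_val_side: "bi_val A f = join (side_cls A f s) (side_cls A f (\<not> s))"
  by (cases s) (auto simp: join_comm)

text \<open>The three degenerate positions that are paths: a centre with one arm, a centre with an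
  additional arm of length 1, and a centre with one arm next to a bare centre. They have
  \<open>n + 1\<close>, \<open>n + 2\<close> and \<open>n + 2\<close> vertices.\<close>

lemma add_arm_values:
  "val (add_arm 0 0 n) = (n + 1) mod 3" "val (add_arm 1 0 n) = (n + 2) mod 3" "join (add_arm 0 0 n) K1s = (n + 2) mod 3"
proof -
  have "n mod 3 = 0 \<or> n mod 3 = 1 \<or> n mod 3 = 2" by auto
  moreover have "(n + 1) mod 3 = (n mod 3 + 1) mod 3" "(n + 2) mod 3 = (n mod 3 + 2) mod 3" by presburger+
  ultimately show "val (add_arm 0 0 n) = (n + 1) mod 3" "val (add_arm 1 0 n) = (n + 2) mod 3"
      "join (add_arm 0 0 n) K1s = (n + 2) mod 3"
    by (elim disjE; simp add: add_arm_def star_cls_def join_def)+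
qed

lemma mod3_sub1:
  assumes "n \<noteq> (0::nat)"
  shows "n - 1 < n" "n \<le> n - 1 + 2" "(n - 1) mod 3 = (n mod 3 + 2) mod 3"
proof -
  obtain m where "n = Suc m" using assms by (cases n) auto
  then show "n - 1 < n" "n \<le> n - 1 + 2" "(n - 1) mod 3 = (n mod 3 + 2) mod 3"
    using mod_add_left_eq[of n 3 2] by simp_all
qed

lemma mod3_sub2:
  assumes "(2::nat) \<le> n"
  shows "n - 2 < n" "n \<le> n - 2 + 2" "(n - 2) mod 3 = (n mod 3 + 1) mod 3"
proof -
  obtain m where "n = m + 2" using assms by (metis add.commute le_Suc_ex)
  then show "n - 2 < n" "n \<le> n - 2 + 2" "(n - 2) mod 3 = (n mod 3 + 1) mod 3"
    using mod_add_left_eq[of n 3 1] by simp_all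
qed

text \<open>Induction on the number of vertices, with \<open>A\<close> and \<open>f\<close> both
  varying because a move may delete a side. Options that are segments are evaluated by
  \<open>gr_segment\<close>, all others by the induction hypothesis.\<close>

theorem gr_config:
  assumes "finite {k. f k \<noteq> 0}"
  shows "gr adj (config A f) = bi_val A f"
  using assms
proof (induction "card (config A f)" arbitrary: A f rule: less_induct)
  case less
  note fin = less.prems
  show ?case
  proof (cases "A = {}")
    case False
    let ?O = "removals adj (config A f)"
    have IH: "gr adj (config A' f') = bi_val A' f'" if "config A' f' \<in> ?O" "finite {k. f' k \<noteq> 0}" for A' f'
    proof (rule less.hyps[OF _ that(2)])
      have "config A' f' \<subset> config A f" using that(1) unfolding removals_def by blast
      then show "card (config A' f') < card (config A f)"
        using finite_config[OF fin] by (simp add: psubset_card_mono)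
    qed
    have "gr adj (config A f) = mex (gr adj ` ?O)"
      by (rule gr_conn[OF sym_adj finite_config[OF fin] conn_config[OF False]])
    also have "\<dots> = bi_val A f"
    proof (rule mex_eqI)
      have "gr adj R \<noteq> bi_val A f" if R: "R \<in> ?O" for R
        using R
      proof (cases rule: removals_config)
        case (arm k m)
        have "gr adj R = bi_val A (f(k := m))"
          using IH[of A "f(k := m)"] R arm finite_support_upd[OF fin] by (simp del: fun_upd_apply)
        also have "\<dots> \<noteq> bi_val A f"
        proof -
          \<comment> \<open>Writing \<open>f\<close> as \<open>f(k := f k)\<close> expresses both
            classes by \<open>add_arm\<close> over the same counts of other arms.\<close>
          have "separated (side_cls A (f(k := m)) (fst k)) (side_cls A (f(k := f k)) (fst k))"
            unfolding side_cls_upd[OF fin] using arm by (simp add: separated_add_arm mod3_neq)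
          moreover have "side_cls A (f(k := m)) (\<not> fst k) = side_cls A f (\<not> fst k)"
            using side_cls_upd[OF fin] by simp
          ultimately show ?thesis
            unfolding bi_val_side[of _ _ "fst k"] by (simp add: separated_def)
        qed
        finally show ?thesis .
      next
        case (side s)
        have "gr adj R = bi_val (A - {s}) f" using IH[of "A - {s}" f] R side(2) fin by simp
        also have "\<dots> \<noteq> bi_val A f"
        proof -
          \<comment> \<open>A side that one move can remove is a bare centre or a centre with one
            vertex attached; both classes are separated from \<open>K0\<close>.\<close>
          have "side_cls A f s = K1s \<or> side_cls A f s = K2s"
            using side(3)
          proof (elim disjE exE conjE)
            fix k assume "fst k = s" "f k = 1" "\<forall>k'. fst k' = s \<longrightarrow> k' \<noteq> k \<longrightarrow> f k' = 0"
            then have "side_cls A f s = add_arm 0 0 1" using side_cls_single[OF fin, of k A] side(1) by simp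
            then show ?thesis by (simp add: add_arm_def star_cls_def)
          qed (use side(1) in \<open>simp add: side_cls_zero\<close>)
          then have "separated (side_cls (A - {s}) f s) (side_cls A f s)"
            by (auto simp: side_cls_def[of "A - {s}"])
          moreover have "side_cls (A - {s}) f (\<not> s) = side_cls A f (\<not> s)" by (simp add: side_cls_def)
          ultimately show ?thesis
            unfolding bi_val_side[of _ _ s] by (simp add: separated_def)
        qed
        finally show ?thesis .
      next
        case (path k a)
        have "bi_val A f = join (side_cls A f (fst k)) (side_cls A f (\<not> fst k))" by (rule bi_val_side)
        also have "side_cls A f (\<not> fst k) = K0" using path(2) by (simp add: side_cls_def)
        also have "side_cls A f (fst k) = add_arm 0 0 (f k)" using side_cls_single[OF fin, of k A] path(2,5) by simp
        also have "join \<dots> K0 = (f k + 1) mod 3" by (simp add: add_arm_values)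
        \<comment> \<open>The position is a path on \<open>f k + 1\<close> vertices, and
          \<open>a <= 1\<close> means that 1 or 2 of them are deleted.\<close>
        finally show ?thesis
          using mod3_neq[of "f k - a" "f k + 1"] path(1,3,4) by (simp add: gr_segment)
      next
        case (path2 k k')
        have "bi_val A f = join (side_cls A f (fst k)) (side_cls A f (\<not> fst k))" by (rule bi_val_side)
        also have "side_cls A f (\<not> fst k) = K0" using path2(2) by (simp add: side_cls_def)
        \<comment> \<open>The deleted arm \<open>k'\<close> has length 1 and supplies the count 1;
          the position is a path on \<open>f k + 2\<close> vertices.\<close>
        also have "side_cls A f (fst k) = add_arm 1 0 (f k)"
        proof -
          have "cnt ((f(k := 0))(k' := 0)) (fst k) r = 0" if "r > 0" for r
            by (rule cnt_zero[OF that]) (use path2(6) in auto)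
          then have "cnt (f(k := 0)) (fst k) 1 = 1" "cnt (f(k := 0)) (fst k) 2 = 0"
            using cnt_split[where f = "f(k := 0)" and s = "fst k" and k = k', OF finite_support_upd[OF fin]] path2(3-5)
            by simp_all
          then show ?thesis using side_cls_upd[OF fin, of A k "f k" "fst k"] path2(2) by simp
        qed
        also have "join \<dots> K0 = (f k + 2) mod 3" by (simp only: join_K0 add_arm_values)
        finally show ?thesis
          using mod3_neq[of "f k" "f k + 2"] path2(1) by (simp add: gr_segment)
      next
        case (ctrs k)
        have "bi_val A f = join (side_cls A f (fst k)) (side_cls A f (\<not> fst k))" by (rule bi_val_side)
        also have "side_cls A f (\<not> fst k) = K1s" using ctrs(2,3) by (intro side_cls_zero) auto
        also have "side_cls A f (fst k) = add_arm 0 0 (f k)" using side_cls_single[OF fin, of k A] ctrs(2,3) by simp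
        also have "join \<dots> K1s = (f k + 2) mod 3" by (rule add_arm_values)
        finally show ?thesis
          using mod3_neq[of "f k" "f k + 2"] ctrs(1) by (simp add: gr_segment)
      qed
      then show "bi_val A f \<notin> gr adj ` ?O" by (metis imageE)
    next
      fix v assume v: "v < bi_val A f"
      \<comment> \<open>Reachability is measured by value: some option has the value that class
        \<open>c\<close> on side \<open>s\<close> would give with the other side untouched.\<close>
      define P where "P s c \<longleftrightarrow> join c (side_cls A f (\<not> s)) \<in> gr adj ` ?O" for s c
      define bare where "bare s \<longleftrightarrow> s \<in> A \<and> (\<forall>k. fst k = s \<longrightarrow> f k = 0)" for s
      have P_arm: "P s (add_arm (cnt (f(k := 0)) s 1) (cnt (f(k := 0)) s 2) m)"
        if "s \<in> A" "fst k = s" "m < f k" "f k \<le> m + 2" for s k m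
      proof -
        have R: "config A (f(k := m)) \<in> ?O" using that by (intro arm_removal) auto
        have "gr adj (config A (f(k := m))) = bi_val A (f(k := m))"
          by (rule IH[OF R finite_support_upd[OF fin]])
        also have "\<dots> = join (side_cls A (f(k := m)) s) (side_cls A (f(k := m)) (\<not> s))" by (rule bi_val_side)
        also have "\<dots> = join (add_arm (cnt (f(k := 0)) s 1) (cnt (f(k := 0)) s 2) m) (side_cls A f (\<not> s))"
          using that by (simp add: side_cls_upd[OF fin])
        finally show ?thesis unfolding P_def using R by (metis imageI)
      qed
      have P_side: "P s K0" if "s \<in> A"
        "(\<forall>k. fst k = s \<longrightarrow> f k = 0) \<or> (\<exists>k. fst k = s \<and> f k = 1 \<and> (\<forall>k'. fst k' = s \<longrightarrow> k' \<noteq> k \<longrightarrow> f k' = 0))" for s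
      proof -
        have R: "config (A - {s}) f \<in> ?O" using that by (rule side_removal)
        have "gr adj (config (A - {s}) f) = bi_val (A - {s}) f" by (rule IH[OF R fin])
        also have "\<dots> = join (side_cls (A - {s}) f s) (side_cls (A - {s}) f (\<not> s))" by (rule bi_val_side)
        also have "\<dots> = join K0 (side_cls A f (\<not> s))" by (simp add: side_cls_def)
        finally show ?thesis unfolding P_def using R by (metis imageI)
      qed
      have cov: "covers (P s) (bare s) (side_cls A f s)" for s
      proof (cases "s \<in> A")
        case True
        let ?a = "cnt f s 1" and ?b = "cnt f s 2"
        have ex: "\<exists>k. fst k = s \<and> f k mod 3 = r" if "cnt f s r > 0" for r
          using that unfolding cnt_def by (metis (mono_tags, lifting) card.empty empty_Collect_eq less_irrefl)
        have cnt0: "cnt f s 1 = cnt (f(k := 0)) s 1 + of_bool (f k mod 3 = 1)"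
          "cnt f s 2 = cnt (f(k := 0)) s 2 + of_bool (f k mod 3 = 2)" if "fst k = s" for k
          using cnt_split[OF fin, of _ s k] that by simp_all
        have step: "P s (star_cls a b)"
          if "fst k = s" "m < f k" "f k \<le> m + 2"
            "a = ?a - of_bool (f k mod 3 = 1) + of_bool (m mod 3 = 1)"
            "b = ?b - of_bool (f k mod 3 = 2) + of_bool (m mod 3 = 2)" for a b k m
          using P_arm[OF True that(1-3)] cnt0[OF that(1)] that(4,5) by (simp add: add_arm_def)
        have "covers (P s) (bare s) (star_cls ?a ?b)"
        proof (rule covers_star_cls)
          assume "?a > 0"
          then obtain k where k: "fst k = s" "f k mod 3 = 1" using ex by blast
          then have "f k \<noteq> 0" by auto
          from mod3_sub1[OF this] show "P s (star_cls (?a - 1) ?b)" using step[of k "f k - 1"] k by simp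
        next
          assume "?b > 0"
          then obtain k where k: "fst k = s" "f k mod 3 = 2" using ex by blast
          have "f k mod 3 \<le> f k" by simp
          then have "f k \<noteq> 0" "2 \<le> f k" using k(2) by auto
          from mod3_sub2[OF this(2)] show "P s (star_cls ?a (?b - 1))" using step[of k "f k - 2"] k by simp
          from mod3_sub1[OF \<open>f k \<noteq> 0\<close>] show "P s (star_cls (Suc ?a) (?b - 1))" using step[of k "f k - 1"] k by simp
        next
          assume ab: "?a = 0" "?b = 0"
          show "P s K0 \<and> (P s K2s \<or> bare s)"
          proof (cases "bare s")
            case False
            \<comment> \<open>A nonempty arm here has length at least 3 and residue 0: losing two
              vertices it yields \<open>star_cls 1 0 = K2s\<close>, losing one
              \<open>star_cls 0 1 = K0\<close>.\<close>
            then obtain k where k: "fst k = s" "f k \<noteq> 0" using True unfolding bare_def by blast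
            have "f k mod 3 \<noteq> 1" "f k mod 3 \<noteq> 2" using cnt0[OF k(1)] ab by auto
            then have r: "f k mod 3 = 0" by presburger
            then have "2 \<le> f k" using k(2) by auto
            from mod3_sub1[OF k(2)] mod3_sub2[OF this] show ?thesis
              using step[of k "f k - 2" 1 0] step[of k "f k - 1" 0 1] k ab r by (simp add: star_cls_def)
          qed (use P_side True in \<open>auto simp: bare_def\<close>)
        next
          assume ab: "?a = 1" "?b = 0"
          then obtain k where k: "fst k = s" "f k mod 3 = 1" using ex[of 1] by auto
          \<comment> \<open>There are three ways to reach \<open>K0\<close>: another nonempty arm
            loses two vertices, giving counts \<open>(2, 0)\<close>; a lone arm longer than 1 loses
            two, giving \<open>(0, 1)\<close>; a lone arm of length 1 goes together with its
            centre.\<close>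
          show "P s K0"
          proof (cases "\<exists>k'. fst k' = s \<and> k' \<noteq> k \<and> f k' \<noteq> 0")
            case True
            then obtain k' where k': "fst k' = s" "k' \<noteq> k" "f k' \<noteq> 0" by blast
            have "cnt (f(k := 0)) s 1 = 0" "cnt (f(k := 0)) s 2 = 0" using cnt0[OF k(1)] k(2) ab by simp_all
            then have "f k' mod 3 \<noteq> 1" "f k' mod 3 \<noteq> 2"
              using cnt_split[where f = "f(k := 0)" and s = s and k = k', OF finite_support_upd[OF fin]] k' by auto
            then have r: "f k' mod 3 = 0" by presburger
            then have "2 \<le> f k'" using k'(3) by auto
            from mod3_sub2[OF this] show ?thesis
              using step[of k' "f k' - 2" 2 0] k' ab r by (simp add: star_cls_def)
          next
            case none: False
            show ?thesis
            proof (cases "f k = 1")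
              case True
              then show ?thesis using P_side \<open>s \<in> A\<close> none k by blast
            next
              case False
              have "f k \<noteq> 0" using k(2) by auto
              then have "2 \<le> f k" using False by simp
              from mod3_sub2[OF this] show ?thesis using step[of k "f k - 2" 0 1] k ab by (simp add: star_cls_def)
            qed
          qed
        qed
        then show ?thesis using True by (simp add: side_cls_def)
      qed (simp add: side_cls_def)
      from join_less[OF cov cov v] show "v \<in> gr adj ` ?O"
      proof (elim disjE exE conjE)
        fix c' assume "P True c'" "join c' (side_cls A f False) = v"
        then show ?thesis by (simp add: P_def)
      next
        fix d' assume "P False d'" "join (side_cls A f True) d' = v"
        then show ?thesis by (simp add: P_def join_comm)
      next
        assume "v = 0" and b: "bare True" "bare False"
        have "A = UNIV" using b by (auto simp: bare_def UNIV_bool)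
        moreover have "f k = 0" for k using b unfolding bare_def by (cases "fst k") auto
        ultimately have "{} \<in> ?O" by (simp add: ctrs_removal)
        then show ?thesis using \<open>v = 0\<close> by (metis gr_empty imageI)
      qed
    qed
    finally show ?thesis .
  qed (simp add: side_cls_def)
qed


section \<open>Classes of stars\<close>

definition sides :: "star \<Rightarrow> star \<Rightarrow> bool set" where
  "sides S T = {s. (if s then S else T) \<noteq> None}"

definition arms :: "star \<Rightarrow> star \<Rightarrow> arm \<Rightarrow> nat" where
  "arms S T k = (case k of (s, l, j) \<Rightarrow>
    (case (if s then S else T) of None \<Rightarrow> 0 | Some L \<Rightarrow> if j < count L l then l else 0))"

text \<open>Counting pairs \<open>(l, j)\<close> accounts for multiplicity and matches the labels of
  arms directly.\<close>

definition residue_count :: "nat multiset \<Rightarrow> nat \<Rightarrow> nat" where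
  "residue_count L r = card {(l, j). j < count L l \<and> l mod 3 = r}"

definition cls_of :: "star \<Rightarrow> cls" where
  "cls_of S = (case S of None \<Rightarrow> K0 | Some L \<Rightarrow> star_cls (residue_count L 1) (residue_count L 2))"

lemma finite_arms: "finite {k. arms S T k \<noteq> 0}"
proof -
  have "finite (Sigma (set_mset L) (\<lambda>l. {..<count L l}))" for L :: "nat multiset" by auto
  moreover have "{k. arms S T k \<noteq> 0} \<subseteq> (\<Union>L\<in>set_option S \<union> set_option T. UNIV \<times> Sigma (set_mset L) (\<lambda>l. {..<count L l}))"
  proof
    fix k assume "k \<in> {k. arms S T k \<noteq> 0}"
    moreover obtain s l j where k: "k = (s, l, j)" by (cases k)
    ultimately obtain L where "(if s then S else T) = Some L" "j < count L l"
      by (auto simp: arms_def split: option.splits if_splits)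
    moreover from this have "l \<in># L" by (metis count_greater_zero_iff gr_implies_not0 not_gr0)
    ultimately show "k \<in> (\<Union>L\<in>set_option S \<union> set_option T. UNIV \<times> Sigma (set_mset L) (\<lambda>l. {..<count L l}))"
      unfolding k by (cases s) auto
  qed
  moreover have "finite (set_option S \<union> set_option T)" by (cases S; cases T) auto
  ultimately show ?thesis by (auto intro: finite_subset)
qed

lemma cnt_arms:
  assumes "r > 0"
  shows "cnt (arms S T) s r = (case (if s then S else T) of None \<Rightarrow> 0 | Some L \<Rightarrow> residue_count L r)"
proof (cases "if s then S else T")
  case None
  have "arms S T k = 0" if "fst k = s" for k
    using None that by (cases k) (simp add: arms_def)
  then show ?thesis unfolding None using cnt_zero[OF assms] by simp
next
  case (Some L)
  have "{k. fst k = s \<and> arms S T k mod 3 = r} = Pair s ` {(l, j). j < count L l \<and> l mod 3 = r}"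
  proof (rule set_eqI)
    fix k :: arm
    obtain s' l j where k: "k = (s', l, j)" by (cases k)
    have "arms S T (s, l, j) = (if j < count L l then l else 0)" unfolding arms_def using Some by simp
    then show "k \<in> {k. fst k = s \<and> arms S T k mod 3 = r} \<longleftrightarrow> k \<in> Pair s ` {(l, j). j < count L l \<and> l mod 3 = r}"
      unfolding k using assms by (cases "s' = s") (auto simp: image_iff split: if_splits)
  qed
  then show ?thesis
    unfolding cnt_def Some residue_count_def by (simp add: card_image inj_on_def)
qed

lemma side_cls_arms: "side_cls (sides S T) (arms S T) s = cls_of (if s then S else T)"
  by (auto simp: side_cls_def cls_of_def cnt_arms sides_def split: option.splits if_splits)

text \<open>An equality rather than an isomorphism, since \<open>pt\<close> uses the very vertices
  of \<open>star_graph\<close>. The assumption \<open>is_star\<close> excludes paths of length 0,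
  for which \<open>star_graph\<close> would have arcs to a missing vertex.\<close>

lemma bistar_eq_relgraph:
  assumes "is_star S" "is_star T"
  shows "bistar S T = relgraph adj (config (sides S T) (arms S T))"
proof -
  let ?W = "config (sides S T) (arms S T)"
  interpret graph "bistar S T" using assms by (rule graph_bistar)
  have th: "tail (bistar S T) = fst" "head (bistar S T) = snd" by (auto simp: bistar_def)
  have arcs_S: "arcs (star_graph (Some L)) = {(Center, Arm l j 1) | l j. j < count L l} \<union>
      {(Arm l j i, Arm l j (Suc i)) | l j i. j < count L l \<and> 1 \<le> i \<and> i < l} \<union>
      ({(Center, Arm l j 1) | l j. j < count L l} \<union>
      {(Arm l j i, Arm l j (Suc i)) | l j i. j < count L l \<and> 1 \<le> i \<and> i < l})\<inverse>" for L
    by (simp add: Let_def)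
  have verts_S: "verts (star_graph (Some L)) = insert Center {Arm l j i | l j i. j < count L l \<and> 1 \<le> i \<and> i \<le> l}" for L
    by (simp add: Let_def)
  have ptT: "pt (True, l, j) (Suc i) = Inl (Arm l j (Suc i))" "pt (False, l, j) (Suc i) = Inr (Arm l j (Suc i))"
    "ctr True = Inl Center" "ctr False = Inr Center" for l j i
    by (simp_all add: pt_def ctr_def)
  have arm_star: "\<exists>L. (if s then S else T) = Some L \<and> j < count L l \<and> i < l"
    if "pt (s, l, j) (Suc i) \<in> ?W" for s l j i
    using that by (auto simp: arms_def sides_def split: option.splits if_splits)
  have verts: "verts (bistar S T) = ?W"
  proof (intro equalityI subsetI)
    fix x assume "x \<in> verts (bistar S T)"
    then consider a where "x = Inl a" "a \<in> verts (star_graph S)" | a where "x = Inr a" "a \<in> verts (star_graph T)"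
      by (auto simp: bistar_def)
    then show "x \<in> ?W"
    proof cases
      case 1
      then obtain L where L: "S = Some L" by (cases S) auto
      from 1 consider "x = ctr True" | l j i where "x = pt (True, l, j) (Suc i)" "j < count L l" "i < l"
        unfolding L verts_S by (auto simp: ptT Suc_le_eq gr0_conv_Suc)
      then show ?thesis by cases (auto simp: L sides_def arms_def)
    next
      case 2
      then obtain L where L: "T = Some L" by (cases T) auto
      from 2 consider "x = ctr False" | l j i where "x = pt (False, l, j) (Suc i)" "j < count L l" "i < l"
        unfolding L verts_S by (auto simp: ptT Suc_le_eq gr0_conv_Suc)
      then show ?thesis by cases (auto simp: L sides_def arms_def)
    qed
  next
    fix x assume W: "x \<in> ?W"
    then show "x \<in> verts (bistar S T)"
    proof (cases rule: config_cases)
      case (ctr s)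
      then show ?thesis
        by (cases s) (auto simp: ptT sides_def bistar_def Let_def)
    next
      case (pt k i)
      obtain s l j where k: "k = (s, l, j)" by (cases k)
      obtain L where "(if s then S else T) = Some L" "j < count L l" "i < l" using arm_star W pt(1) k by blast
      then show ?thesis unfolding pt(1) k
        by (cases s) (auto simp: ptT bistar_def verts_S simp del: star_graph.simps)
    qed
  qed
  have arcs: "arcs (bistar S T) = adj \<inter> ?W \<times> ?W"
  proof (intro equalityI subsetI)
    fix e assume e: "e \<in> arcs (bistar S T)"
    have "e \<in> ?W \<times> ?W"
      using tail_in_verts[OF e] head_in_verts[OF e] unfolding verts th by (simp add: mem_Times_iff)
    moreover have "e \<in> adj"
    proof -
      have star: "(x, y) \<in> {(Center, Arm l j 1) | l j. True} \<union> {(Arm l j (Suc i), Arm l j (Suc (Suc i))) | l j i. True} \<union>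
          ({(Center, Arm l j 1) | l j. True} \<union> {(Arm l j (Suc i), Arm l j (Suc (Suc i))) | l j i. True})\<inverse>"
        if "(x, y) \<in> arcs (star_graph U)" for x y U
        using that by (cases U) (auto simp: arcs_S Suc_le_eq gr0_conv_Suc simp del: star_graph.simps(2))
      have "(pt k i, pt k (Suc i)) \<in> adj" "(pt k (Suc i), pt k i) \<in> adj" for k i
        unfolding adj_def by blast+
      note p = this[of "(True, _, _)" 0] this[of "(True, _, _)" "Suc _"]
        this[of "(False, _, _)" 0] this[of "(False, _, _)" "Suc _"]
      have "(Inl x, Inl y) \<in> adj" "(Inr x, Inr y) \<in> adj" if "(x, y) \<in> arcs (star_graph U)" for x y U
        using star[OF that] p by (auto simp: ptT)
      moreover have "(Inl Center, Inr Center) \<in> adj" "(Inr Center, Inl Center) \<in> adj"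
        using adj_ctr_iff[of True] adj_ctr_iff[of False] by (simp_all add: ptT)
      ultimately show ?thesis
        using e by (auto simp: bistar_def simp del: star_graph.simps split: if_splits)
    qed
    ultimately show "e \<in> adj \<inter> ?W \<times> ?W" by blast
  next
    \<comment> \<open>Only outward arcs are checked directly; symmetry of the arc set gives the
      inward ones.\<close>
    have fwd: "(pt k i, pt k (Suc i)) \<in> arcs (bistar S T)" if W: "pt k (Suc i) \<in> ?W" for k i
    proof -
      obtain s l j where k: "k = (s, l, j)" by (cases k)
      obtain L where "(if s then S else T) = Some L" "j < count L l" "i < l" using arm_star W k by blast
      then have L: "(if s then S else T) = Some L" "j < count L l" "i < l" by auto
      have "(if i = 0 then Center else Arm l j i, Arm l j (Suc i)) \<in> arcs (star_graph (Some L))"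
        unfolding arcs_S using L(2,3) by auto
      then have "map_prod (if s then Inl else Inr) (if s then Inl else Inr)
          (if i = 0 then Center else Arm l j i, Arm l j (Suc i)) \<in> arcs (bistar S T)"
        using L(1) unfolding bistar_def by (cases s) (auto simp del: star_graph.simps)
      then show ?thesis unfolding k pt_def by (simp split: if_splits)
    qed
    have "sym (arcs (bistar S T))"
      using sym_arcs by (auto simp: symmetric_def arcs_ends_def arc_to_ends_def th)
    note rev = symD[OF this]
    fix e assume "e \<in> adj \<inter> ?W \<times> ?W"
    then have e: "e \<in> adj" "fst e \<in> ?W" "snd e \<in> ?W" by auto
    from e(1) consider k i where "e = (pt k i, pt k (Suc i))" | k i where "e = (pt k (Suc i), pt k i)"
      | s where "e = (ctr s, ctr (\<not> s))" unfolding adj_def by blast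
    then show "e \<in> arcs (bistar S T)"
    proof cases
      case 1
      then show ?thesis using fwd e by simp
    next
      case 2
      then show ?thesis using fwd rev e by simp
    next
      case 3
      then have "s \<in> sides S T" "(\<not> s) \<in> sides S T" using e by simp_all
      then have "S \<noteq> None" "T \<noteq> None" by (cases s; simp add: sides_def)+
      then show ?thesis unfolding 3 by (cases s) (auto simp: ptT bistar_def)
    qed
  qed
  show ?thesis
    by (rule pre_digraph.equality) (simp_all add: verts arcs th)
qed

lemma grundy_bistar:
  assumes "is_star S" "is_star T"
  shows "grundy (bistar S T) = join (cls_of S) (cls_of T)"
  unfolding bistar_eq_relgraph[OF assms] gr_config[OF finite_arms] side_cls_arms by simp

text \<open>A star and its bistar with the empty graph have vertices of different types. Pulling
  \<open>adj\<close> back along \<open>Inl\<close> makes the star an induced subgraph of a symmetric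
  relation, and \<open>gr_image\<close> transfers the value.\<close>

lemma star_grundy_eq:
  assumes "is_star S"
  shows "star_grundy S = val (cls_of S)"
proof -
  define F where "F = {(x, y). (Inl x :: star_vertex + star_vertex, Inl y :: star_vertex + star_vertex) \<in> adj}"
  let ?V = "verts (star_graph S)" and ?W = "config (sides S None) (arms S None)"
  have N: "is_star None" by (simp add: is_star_def)
  note eq = bistar_eq_relgraph[OF assms N]
  have V: "Inl ` ?V = ?W" using arg_cong[OF eq, of verts] by (simp add: bistar_def)
  have "map_prod Inl Inl ` arcs (star_graph S) = adj \<inter> Inl ` ?V \<times> Inl ` ?V"
    using arg_cong[OF eq, of arcs] unfolding V by (simp add: bistar_def)
  also have "\<dots> = map_prod Inl Inl ` (F \<inter> ?V \<times> ?V)" unfolding F_def by auto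
  finally have "arcs (star_graph S) = F \<inter> ?V \<times> ?V"
    by (rule inj_image_eq_iff[THEN iffD1, rotated]) (auto simp: prod.inj_map)
  then have S: "star_graph S = relgraph F ?V"
    by (intro pre_digraph.equality) (cases S; simp add: Let_def)+
  have fin: "finite ?V" using assms by (meson graph_star_graph fin_digraph.finite_verts graph_def digraph.axioms)
  have h: "(Inl x, Inl y) \<in> adj \<longleftrightarrow> (x, y) \<in> F" for x y by (simp add: F_def)
  have "?W = {} \<or> conn adj ?W"
    using conn_config[of "sides S None" "arms S None"] by (cases "sides S None = {}") (simp_all only: config_empty simp_thms)
  then have c: "?V = {} \<or> conn F ?V"
    unfolding V[symmetric] using conn_image[of Inl adj F ?V, OF inj_Inl h] by simp
  have "sym F" using sym_adj unfolding F_def sym_def by blast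
  then have "gr adj (Inl ` ?V) = gr F ?V"
    by (rule gr_image[OF _ sym_adj inj_Inl h fin c])
  then have "star_grundy S = grundy (bistar S None)"
    unfolding star_grundy_def eq V using S by simp
  also have "\<dots> = val (cls_of S)" using grundy_bistar[OF assms N] by (simp add: cls_of_def)
  finally show ?thesis .
qed


section \<open>Stars with paths of one or two vertices\<close>

lemma is_star_stars12: "S \<in> stars12 \<Longrightarrow> is_star S"
  by (auto simp: stars12_def is_star_def)

lemma cls_of_stars12:
  assumes "set_mset L \<subseteq> {1, 2}"
  shows "cls_of (Some L) = star_cls (count L 1) (count L 2)"
proof -
  have pos: "l = 1 \<or> l = 2" if "j < count L l" for l j
    using that assms by (metis count_inI empty_iff insertE less_nat_zero_code subsetD)
  have "{(l, j). j < count L l \<and> l mod 3 = 1} = {1} \<times> {..<count L 1}"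
    "{(l, j). j < count L l \<and> l mod 3 = 2} = {2} \<times> {..<count L 2}"
    using pos by force+
  then show ?thesis by (simp add: cls_of_def residue_count_def)
qed

definition star12 :: "nat \<Rightarrow> nat \<Rightarrow> star" where
  "star12 a b = Some (replicate_mset a 1 + replicate_mset b 2)"

lemma stars12_cases:
  assumes "S \<in> stars12"
  obtains "S = None" "cls_of S = K0"
  | a b where "S = star12 a b" "cls_of S = star_cls a b"
proof (cases S)
  case None
  then show ?thesis using that(1) by (simp add: cls_of_def)
next
  case (Some L)
  then have L: "set_mset L \<subseteq> {1, 2}" using assms by (auto simp: stars12_def)
  have "L = replicate_mset (count L 1) 1 + replicate_mset (count L 2) 2"
  proof (rule multiset_eqI)
    fix x
    show "count L x = count (replicate_mset (count L 1) 1 + replicate_mset (count L 2) 2) x"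
      using L by (cases "x \<in># L") (auto simp: not_in_iff)
  qed
  then show ?thesis using that(2)[of "count L 1" "count L 2"] Some cls_of_stars12[OF L] by (simp add: star12_def)
qed

lemma star12_in_stars12: "star12 a b \<in> stars12"
  by (auto simp: stars12_def star12_def dest: in_replicate_mset[THEN iffD1])

lemma cls_of_star12: "cls_of (star12 a b) = star_cls a b"
  unfolding star12_def by (subst cls_of_stars12) (auto dest: in_replicate_mset[THEN iffD1])

lemma star12_eq_iff: "star12 a b = star12 a' b' \<longleftrightarrow> a = a' \<and> b = b'"
proof
  assume "star12 a b = star12 a' b'"
  then have eq: "replicate_mset a 1 + replicate_mset b 2 = replicate_mset a' 1 + replicate_mset b' (2::nat)"
    by (simp add: star12_def)
  from arg_cong[OF eq, of "\<lambda>M. count M 1"] arg_cong[OF eq, of "\<lambda>M. count M 2"]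
  show "a = a' \<and> b = b'" by simp
qed simp

lemma mem_C1_star_iff:
  assumes "S \<in> stars12"
  shows "S \<in> C1_star \<longleftrightarrow> cls_of S = K1s"
  using assms
proof (cases rule: stars12_cases)
  case (2 a b)
  have eq: "C1_star = {star12 0 0, star12 1 1, star12 0 3}"
    by (simp add: C1_star_def star12_def numeral_eq_Suc add_mset_commute)
  have "S \<in> C1_star \<longleftrightarrow> a = 0 \<and> b = 0 \<or> a = 1 \<and> b = 1 \<or> a = 0 \<and> b = 3"
    unfolding 2(1) eq by (simp only: insert_iff empty_iff star12_eq_iff simp_thms)
  also have "\<dots> \<longleftrightarrow> cls_of S = K1s" unfolding 2(2) star_cls_def by auto
  finally show ?thesis .
qed (auto simp: C1_star_def)

lemma mem_C2_star_iff:
  assumes "S \<in> stars12"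
  shows "S \<in> C2_star \<longleftrightarrow> cls_of S = K2s"
  using assms
proof (cases rule: stars12_cases)
  case (2 a b)
  have eq: "C2_star = {star12 1 0, star12 0 2}"
    by (simp add: C2_star_def star12_def numeral_eq_Suc)
  have "S \<in> C2_star \<longleftrightarrow> a = 1 \<and> b = 0 \<or> a = 0 \<and> b = 2"
    unfolding 2(1) eq by (simp only: insert_iff empty_iff star12_eq_iff simp_thms)
  also have "\<dots> \<longleftrightarrow> cls_of S = K2s" unfolding 2(2) star_cls_def by auto
  finally show ?thesis .
qed (auto simp: C2_star_def)

text \<open>For \<open>b = 1\<close> or \<open>b = 3\<close> the only stars outside the box classes
  have counts \<open>(0, 1)\<close>, \<open>(1, 1)\<close> and \<open>(0, 3)\<close>. Their values
  are 0 or 1, so value 2 or 3 forces a box class.\<close>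

lemma mem_C_box_iff:
  assumes "S \<in> stars12"
  shows "S \<in> C_box 2 \<longleftrightarrow> cls_of S = K2b" "S \<in> C_box 3 \<longleftrightarrow> cls_of S = K3b"
proof -
  have "S \<in> C_box i \<longleftrightarrow> val (cls_of S) = i \<and> (\<exists>L. S = Some L \<and> (count L 2 = 1 \<or> count L 2 = 3))" for i
    using assms by (simp add: C_box_def star_grundy_eq is_star_stars12)
  moreover from assms
  have "val (cls_of S) = 2 \<and> (\<exists>L. S = Some L \<and> (count L 2 = 1 \<or> count L 2 = 3)) \<longleftrightarrow> cls_of S = K2b"
    "val (cls_of S) = 3 \<and> (\<exists>L. S = Some L \<and> (count L 2 = 1 \<or> count L 2 = 3)) \<longleftrightarrow> cls_of S = K3b"
    by (cases rule: stars12_cases; auto simp: star12_def star_cls_def split: if_splits)+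
  ultimately show "S \<in> C_box 2 \<longleftrightarrow> cls_of S = K2b" "S \<in> C_box 3 \<longleftrightarrow> cls_of S = K3b" by simp_all
qed

lemma mem_C_iff:
  assumes "S \<in> stars12"
  shows "S \<in> C 0 \<longleftrightarrow> cls_of S = K0" "S \<in> C 1 \<longleftrightarrow> cls_of S = K1"
    "S \<in> C 2 \<longleftrightarrow> cls_of S = K2" "S \<in> C 3 \<longleftrightarrow> cls_of S = K3"
proof -
  have "S \<in> C i \<longleftrightarrow> val (cls_of S) = i \<and> cls_of S \<notin> {K1s, K2s, K2b, K3b}" for i
    using assms unfolding C_def
    by (simp add: star_grundy_eq is_star_stars12 mem_C1_star_iff mem_C2_star_iff mem_C_box_iff)
  then show "S \<in> C 0 \<longleftrightarrow> cls_of S = K0" "S \<in> C 1 \<longleftrightarrow> cls_of S = K1"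
    "S \<in> C 2 \<longleftrightarrow> cls_of S = K2" "S \<in> C 3 \<longleftrightarrow> cls_of S = K3"
    by (cases "cls_of S"; simp)+
qed

lemma classes_subset: "C i \<subseteq> stars12" "C_box i \<subseteq> stars12" "C1_star \<subseteq> stars12" "C2_star \<subseteq> stars12"
  by (auto simp: C_def C_box_def C1_star_def C2_star_def stars12_def)

text \<open>Three tests tell the eight classes apart. The empty graph gives the Grundy value; a
  single vertex separates \<open>K1\<close> from \<open>K1s\<close> and \<open>K2s\<close> from
  \<open>K2\<close> and \<open>K2b\<close>; the star with one path of length 1 separates
  \<open>K2\<close> from \<open>K2b\<close> and \<open>K3\<close> from \<open>K3b\<close>.\<close>

lemma sim1_iff:
  assumes "S \<in> stars12" "S' \<in> stars12"
  shows "S \<sim>\<^sub>1 S' \<longleftrightarrow> cls_of S = cls_of S'"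
proof
  note star = assms[THEN is_star_stars12]
  show "S \<sim>\<^sub>1 S'" if "cls_of S = cls_of S'"
    using that star by (simp add: sim1_def grundy_bistar)
  assume "S \<sim>\<^sub>1 S'"
  then have eq: "join (cls_of S) (cls_of T) = join (cls_of S') (cls_of T)" if "is_star T" for T
    using star that by (simp add: sim1_def grundy_bistar)
  have "cls_of None = K0" "cls_of (Some {#}) = K1s" "cls_of (Some {#1#}) = K2s"
    by (simp_all add: cls_of_stars12 star_cls_def) (simp add: cls_of_def)
  then have "join (cls_of S) c = join (cls_of S') c" if "c \<in> {K0, K1s, K2s}" for c
    using eq[of None] eq[of "Some {#}"] eq[of "Some {#1#}"] that by (auto simp: is_star_def)
  from this[of K0] this[of K1s] this[of K2s] show "cls_of S = cls_of S'"
    by (cases "cls_of S"; cases "cls_of S'") (simp_all add: join_def)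
qed

text \<open>Surjectivity makes each fibre nonempty, hence an actual equivalence class.\<close>

lemma quotient_eq_fibres:
  assumes "g ` A = UNIV"
  shows "A // {(x, y). x \<in> A \<and> y \<in> A \<and> g x = g y} = range (\<lambda>c. {x \<in> A. g x = c})"
proof -
  have "{(x, y). x \<in> A \<and> y \<in> A \<and> g x = g y} `` {x} = {y \<in> A. g y = g x}" if "x \<in> A" for x
    using that by auto
  then have "A // {(x, y). x \<in> A \<and> y \<in> A \<and> g x = g y} = (\<lambda>x. {y \<in> A. g y = g x}) ` A"
    by (auto simp: quotient_def)
  also have "\<dots> = (\<lambda>c. {y \<in> A. g y = c}) ` g ` A" by (simp add: image_image)
  finally show ?thesis using assms by simp
qed

lemma cls_of_surj: "cls_of ` stars12 = UNIV"
proof -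
  have img: "star_cls a b \<in> cls_of ` stars12" for a b
    using star12_in_stars12 cls_of_star12 by (metis imageI)
  have "\<exists>a b. star_cls a b = c" for c
  proof (cases c)
    case K0 then show ?thesis by (intro exI[of _ 0] exI[of _ 1]) (simp add: star_cls_def)
  next
    case K1 then show ?thesis by (intro exI[of _ 3] exI[of _ 0]) (simp add: star_cls_def)
  next
    case K1s then show ?thesis by (intro exI[of _ 0] exI[of _ 0]) (simp add: star_cls_def)
  next
    \<comment> \<open>The plain classes \<open>K2\<close> and \<open>K3\<close> require an odd
      \<open>b\<close> other than 1 and 3, so 5 is the least possible.\<close>
    case K2 then show ?thesis by (intro exI[of _ 0] exI[of _ 5]) (simp add: star_cls_def)
  next
    case K2s then show ?thesis by (intro exI[of _ 1] exI[of _ 0]) (simp add: star_cls_def)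
  next
    case K2b then show ?thesis by (intro exI[of _ 2] exI[of _ 1]) (simp add: star_cls_def)
  next
    case K3 then show ?thesis by (intro exI[of _ 1] exI[of _ 5]) (simp add: star_cls_def)
  next
    case K3b then show ?thesis by (intro exI[of _ 3] exI[of _ 1]) (simp add: star_cls_def)
  qed
  then show ?thesis using img by (metis UNIV_eq_I)
qed

theorem theorem5:
  shows "stars12 // {(S, S'). S \<in> stars12 \<and> S' \<in> stars12 \<and> S \<sim>\<^sub>1 S'} =
           {C 0, C 1, C1_star, C 2, C2_star, C_box 2, C 3, C_box 3} \<and>
         (\<forall>S \<in> stars12. \<forall>S' \<in> stars12. grundy (bistar S S') =
           (if S \<in> C1_star \<and> S' \<in> C1_star then 2
            else if S \<in> C1_star \<and> S' \<in> C2_star \<or> S \<in> C2_star \<and> S' \<in> C1_star then 0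
            else if S \<in> C2_star \<and> S' \<in> C2_star then 1
            else if S \<in> C2_star \<and> S' \<in> C_box 2 \<or> S \<in> C_box 2 \<and> S' \<in> C2_star then 1
            else if S \<in> C2_star \<and> S' \<in> C_box 3 \<or> S \<in> C_box 3 \<and> S' \<in> C2_star then 0
            else xor (star_grundy S) (star_grundy S')))"
proof
  let ?fib = "\<lambda>c. {S \<in> stars12. cls_of S = c}"
  have "{(S, S'). S \<in> stars12 \<and> S' \<in> stars12 \<and> S \<sim>\<^sub>1 S'} =
      {(S, S'). S \<in> stars12 \<and> S' \<in> stars12 \<and> cls_of S = cls_of S'}"
    by (auto simp: sim1_iff)
  then have "stars12 // {(S, S'). S \<in> stars12 \<and> S' \<in> stars12 \<and> S \<sim>\<^sub>1 S'} = range ?fib"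
    by (simp add: quotient_eq_fibres cls_of_surj)
  also have "\<dots> = {?fib K0, ?fib K1, ?fib K1s, ?fib K2, ?fib K2s, ?fib K2b, ?fib K3, ?fib K3b}"
  proof -
    have "(UNIV :: cls set) = {K0, K1, K1s, K2, K2s, K2b, K3, K3b}"
      by (auto intro: cls.exhaust)
    then have "range ?fib = ?fib ` {K0, K1, K1s, K2, K2s, K2b, K3, K3b}" by (rule arg_cong)
    then show ?thesis by (simp only: image_insert image_empty)
  qed
  also have "\<dots> = {C 0, C 1, C1_star, C 2, C2_star, C_box 2, C 3, C_box 3}"
  proof -
    have fib: "?fib c = X" if "X \<subseteq> stars12" "\<forall>S\<in>stars12. S \<in> X \<longleftrightarrow> cls_of S = c" for X c
      using that by blast
    have "?fib K0 = C 0" "?fib K1 = C 1" "?fib K1s = C1_star" "?fib K2 = C 2"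
      "?fib K2s = C2_star" "?fib K2b = C_box 2" "?fib K3 = C 3" "?fib K3b = C_box 3"
      by (rule fib; simp add: classes_subset mem_C_iff(2)[unfolded One_nat_def] mem_C_iff mem_C1_star_iff mem_C2_star_iff mem_C_box_iff)+
    then show ?thesis by (simp only:)
  qed
  finally show "stars12 // {(S, S'). S \<in> stars12 \<and> S' \<in> stars12 \<and> S \<sim>\<^sub>1 S'} =
      {C 0, C 1, C1_star, C 2, C2_star, C_box 2, C 3, C_box 3}" .
qed (simp add: grundy_bistar star_grundy_eq is_star_stars12 join_def mem_C1_star_iff mem_C2_star_iff mem_C_box_iff)

end
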